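(* Let $\mathcal{B}$ be a decorated bicategory. Let $Q_\mathcal{B}$ be the pair consisting of the category $\mathcal{B}^*$ and the category $V_\infty$ associated to $\mathcal{B}$. Then $Q_\mathcal{B}$, together with the functors $s_\infty,t_\infty:V_\infty\to\mathcal{B}^*$, the functor $i:\mathcal{B}^*\to V_\infty$, the functor $\ast_\infty:V_\infty\times_{\mathcal{B}^*}V_\infty\to V_\infty$, and the collections of left and right identity transformations and associator of $\mathcal{B}$, is a double category. Moreover, with this structure, the double category $Q_\mathcal{B}$ is globularily generated.
   Context: Double category means pseudo double category: categories $C_0,C_1$, functors $s,t:C_1\to C_0$, $i:C_0\to C_1$, $\ast:C_1\times_{C_0}C_1\to C_1$ (sending a pair $(\Phi,\Psi)$ with $t\Phi=s\Psi$ to $\Psi\ast\Phi$), compatible with sources and targets, and natural isomorphisms $\lambda,\rho,A$ (left and right identity transformations and associator) with globular components satisfying the triangle and pentagon axioms. Objects of $C_1$ are horizontal morphisms, morphisms of $C_1$ are squares (composition in $C_1$ is vertical composition), morphisms of $C_0$ are vertical morphisms. A square is globular if its images under $s$ and $t$ are identities. $C$ is globularily generated if every square of $C$ is obtained by finitely many vertical and horizontal compositions from globular squares and horizontal identity squares $i_f$ of vertical morphisms $f$. A decorated bicategory is a bicategory $\mathcal{B}$ (with collections $\mathcal{B}_0,\mathcal{B}_1,\mathcal{B}_2$ of 0-, 1-, 2-cells, horizontal composition $\ast$, horizontal identity 1-cells $i_a$, identity transformations $\lambda,\rho$, and associator $A$ with components $f(gh)\to(fg)h$) together with a category $\mathcal{B}^*$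 (the decoration) whose collection of objects is $\mathcal{B}_0$. Construction of $V_\infty$. Let $\mathbb{G}$ be the union of the collection of 2-cells ("globular squares") of $\mathcal{B}$ and the collection of formal symbols $i_f$, one for each morphism $f$ of $\mathcal{B}^*$. For a 2-cell $\varphi:\alpha\Rightarrow\beta$ with $\alpha,\beta:a\to b$, put $d\varphi=\alpha$, $c\varphi=\beta$, $s\varphi=id_a$, $t\varphi=id_b$ (identities in $\mathcal{B}^*$). For $f:a\to b$ in $\mathcal{B}^*$ put $d(i_f)=i_a$, $c(i_f)=i_b$, $s(i_f)=t(i_f)=f$. Let $E_1$ be the set of all parenthesized words $x_n\cdots x_1$ ($n\ge1$) in $\mathbb{G}$ with $tx_j=sx_{j+1}$; $d$ and $c$ of such a word are the composites in $\mathcal{B}_1$ of the $d x_j$, resp. $c x_j$, following the same parenthesization; $s$ is $sx_1$ and $t$ is $tx_n$. Let $F_1$ be the free (path) category with objects $\mathcal{B}_1$ generated by $E_1$ with domain $d$ and codomain $c$; $s,t$ extend to functors $F_1\to\mathcal{B}^*$ (on objects: domain and codomain of 1-cells). Inductively $E_{k+1}$ is the set of parenthesized words $x_n\cdots x_1$ in $\mathrm{Hom}_{F_k}$ with $tx_j=sx_{j+1}$, with $d,c,s,t$ defined in the same way, and $F_{k+1}$ is the free category with objects $\mathcal{B}_1$ generated by $E_{k+1}$. Regard $E_k\subseteq\mathrm{Hom}_{F_k}\subseteq E_{k+1}$ via paths of length one and words of length one, and let $E_\infty=\bigcup_kE_k$, the set of morphisms of the limit category $F_\infty=\varinjlim F_k$;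 denote by $d_\infty,c_\infty,s_\infty,t_\infty$ the resulting boundary maps, by $\bullet_\infty$ the (vertical) composition and by $\ast_\infty$ the concatenation $(\Phi,\Psi)\mapsto\Psi\ast_\infty\Phi$, defined when $t_\infty\Phi=s_\infty\Psi$ (formal composites which differ only through the inclusions $E_k\subseteq\mathrm{Hom}_{F_k}\subseteq E_{k+1}$ are identified). $R_\infty$ is the smallest equivalence relation on $E_\infty$ compatible with $\bullet_\infty$ and $\ast_\infty$ such that, whenever the expressions are defined: (1) $(\Psi_2\ast_\infty\Psi_1)\bullet_\infty(\Phi_2\ast_\infty\Phi_1)\sim(\Psi_2\bullet_\infty\Phi_2)\ast_\infty(\Psi_1\bullet_\infty\Phi_1)$; (2) $\Psi\bullet_\infty\Phi\sim\Psi\Phi$ (vertical composition in $\mathcal{B}$) for vertically composable 2-cells $\Phi,\Psi$ of $\mathcal{B}$, and $i_g\bullet_\infty i_f\sim i_{gf}$ for composable morphisms $f,g$ of $\mathcal{B}^*$; also identities agree: the identity morphism of $F_\infty$ at a 1-cell $\alpha$ is identified with the identity 2-cell of $\alpha$, and $i_{id_a}$ with the identity 2-cell of the 1-cell $i_a$; (3) $\Psi\ast_\infty\Phi\sim\Psi\ast\Phi$ (horizontal composition in $\mathcal{B}$) for horizontally composable 2-cells of $\mathcal{B}$; (4) $\Phi\sim\lambda_{c_\infty\Phi}\bullet_\infty(i_{t_\infty\Phi}\ast_\infty\Phi)\bullet_\infty\lambda_{d_\infty\Phi}^{-1}$ and $\Phi\sim\rho_{c_\infty\Phi}\bullet_\infty(\Phi\ast_\infty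 i_{s_\infty\Phi})\bullet_\infty\rho_{d_\infty\Phi}^{-1}$; (5) $A\bullet_\infty[\Theta\ast_\infty(\Psi\ast_\infty\Phi)]\sim[(\Theta\ast_\infty\Psi)\ast_\infty\Phi]\bullet_\infty A$, where the two $A$'s are the associator components at the codomains, respectively the domains, of $\Phi,\Psi,\Theta$. Then $V_\infty=F_\infty/R_\infty$; $s_\infty,t_\infty,\ast_\infty$ denote the induced functors on $V_\infty$ (on horizontal morphisms $\ast_\infty$ is composition of 1-cells of $\mathcal{B}$); $i:\mathcal{B}^*\to V_\infty$ sends an object $a$ to the 1-cell $i_a$ and a morphism $f$ to the class of $i_f$. *)

theory Defs
  imports Main
begin

section \<open>Categories, functors, natural isomorphisms\<close>

text \<open>All structures live on explicit carriers; operations are only meaningful on (composable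
  elements of) the carriers. \<open>Cmp C g f\<close> is the composite of \<open>g\<close> after \<open>f\<close>.\<close>

record ('o, 'm) cat =
  Obj :: "'o set"
  Mor :: "'m set"
  Dom :: "'m \<Rightarrow> 'o"
  Cod :: "'m \<Rightarrow> 'o"
  Ide :: "'o \<Rightarrow> 'm"
  Cmp :: "'m \<Rightarrow> 'm \<Rightarrow> 'm"

locale category =
  fixes C :: "('o, 'm) cat"
  assumes Dom_Cod: "f \<in> Mor C \<Longrightarrow> Dom C f \<in> Obj C \<and> Cod C f \<in> Obj C"
    and Ide: "a \<in> Obj C \<Longrightarrow> Ide C a \<in> Mor C \<and> Dom C (Ide C a) = a \<and> Cod C (Ide C a) = a"
    and Cmp: "\<lbrakk>f \<in> Mor C; g \<in> Mor C; Dom C g = Cod C f\<rbrakk> \<Longrightarrow>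
      Cmp C g f \<in> Mor C \<and> Dom C (Cmp C g f) = Dom C f \<and> Cod C (Cmp C g f) = Cod C g"
    and Cmp_Ide: "f \<in> Mor C \<Longrightarrow> Cmp C f (Ide C (Dom C f)) = f \<and> Cmp C (Ide C (Cod C f)) f = f"
    and Cmp_assoc: "\<lbrakk>f \<in> Mor C; g \<in> Mor C; h \<in> Mor C; Dom C g = Cod C f; Dom C h = Cod C g\<rbrakk> \<Longrightarrow>
      Cmp C h (Cmp C g f) = Cmp C (Cmp C h g) f"

definition inverse_of :: "('o, 'm) cat \<Rightarrow> 'm \<Rightarrow> 'm \<Rightarrow> bool" where
  "inverse_of C f g \<longleftrightarrow> f \<in> Mor C \<and> g \<in> Mor C \<and> Dom C g = Cod C f \<and> Cod C g = Dom C f \<and>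
     Cmp C g f = Ide C (Dom C f) \<and> Cmp C f g = Ide C (Cod C f)"

definition inv_mor :: "('o, 'm) cat \<Rightarrow> 'm \<Rightarrow> 'm" where
  "inv_mor C f = (THE g. inverse_of C f g)"

record ('o, 'm, 'p, 'n) cat_map =
  on_obj :: "'o \<Rightarrow> 'p"
  on_mor :: "'m \<Rightarrow> 'n"

locale is_functor = C: category C + D: category D
  for C :: "('o, 'm) cat" and D :: "('p, 'n) cat" +
  fixes F :: "('o, 'm, 'p, 'n) cat_map"
  assumes on_obj: "a \<in> Obj C \<Longrightarrow> on_obj F a \<in> Obj D"
    and on_mor: "f \<in> Mor C \<Longrightarrow> on_mor F f \<in> Mor D \<and>
      Dom D (on_mor F f) = on_obj F (Dom C f) \<and> Cod D (on_mor F f) = on_obj F (Cod C f)"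
    and on_Ide: "a \<in> Obj C \<Longrightarrow> on_mor F (Ide C a) = Ide D (on_obj F a)"
    and on_Cmp: "\<lbrakk>f \<in> Mor C; g \<in> Mor C; Dom C g = Cod C f\<rbrakk> \<Longrightarrow>
      on_mor F (Cmp C g f) = Cmp D (on_mor F g) (on_mor F f)"

locale natural_isomorphism = F: is_functor C D F + G: is_functor C D G
  for C :: "('o, 'm) cat" and D :: "('p, 'n) cat"
    and F :: "('o, 'm, 'p, 'n) cat_map" and G :: "('o, 'm, 'p, 'n) cat_map" +
  fixes \<eta> :: "'o \<Rightarrow> 'n"
  assumes component: "a \<in> Obj C \<Longrightarrow> \<eta> a \<in> Mor D \<and>
      Dom D (\<eta> a) = on_obj F a \<and> Cod D (\<eta> a) = on_obj G a"
    and invertible: "a \<in> Obj C \<Longrightarrow> \<exists>g. inverse_of D (\<eta> a) g"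
    and natural: "f \<in> Mor C \<Longrightarrow>
      Cmp D (\<eta> (Cod C f)) (on_mor F f) = Cmp D (on_mor G f) (\<eta> (Dom C f))"

definition id_map :: "('o, 'm, 'o, 'm) cat_map" where
  "id_map = \<lparr>on_obj = (\<lambda>a. a), on_mor = (\<lambda>f. f)\<rparr>"

definition prod_cat :: "('o, 'm) cat \<Rightarrow> ('p, 'n) cat \<Rightarrow> ('o \<times> 'p, 'm \<times> 'n) cat" where
  "prod_cat C D =
    \<lparr>Obj = Obj C \<times> Obj D,
     Mor = Mor C \<times> Mor D,
     Dom = map_prod (Dom C) (Dom D),
     Cod = map_prod (Cod C) (Cod D),
     Ide = map_prod (Ide C) (Ide D),
     Cmp = (\<lambda>(g, g') (f, f'). (Cmp C g f, Cmp D g' f'))\<rparr>"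

definition pullback ::
    "('o, 'm) cat \<Rightarrow> ('p, 'n) cat \<Rightarrow> ('o, 'm, 'q, 'k) cat_map \<Rightarrow> ('p, 'n, 'q, 'k) cat_map \<Rightarrow>
     ('o \<times> 'p, 'm \<times> 'n) cat" where
  "pullback C D F G = (prod_cat C D)
    \<lparr>Obj := {(a, b) \<in> Obj C \<times> Obj D. on_obj F a = on_obj G b},
     Mor := {(f, g) \<in> Mor C \<times> Mor D. on_mor F f = on_mor G g}\<rparr>"

text \<open>The quotient of a category by a congruence that relates only parallel morphisms.
  Induced operations on classes are the unique common value on all representatives.\<close>

definition quotient_cat :: "('o, 'm) cat \<Rightarrow> ('m \<times> 'm) set \<Rightarrow> ('o, 'm set) cat" where
  "quotient_cat C R =
    \<lparr>Obj = Obj C,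
     Mor = Mor C // R,
     Dom = (\<lambda>X. the_elem (Dom C ` X)),
     Cod = (\<lambda>X. the_elem (Cod C ` X)),
     Ide = (\<lambda>a. R `` {Ide C a}),
     Cmp = (\<lambda>Y X. the_elem {R `` {Cmp C y x} | x y. x \<in> X \<and> y \<in> Y})\<rparr>"


section \<open>Bicategories and decorated bicategories\<close>

text \<open>The field \<open>cells\<close> is the disjoint union of the hom-categories: its objects are the 1-cells,
  its morphisms the 2-cells, its composition the vertical composition. Horizontal composites are
  written in the order of composition of maps: \<open>hcomp1 B \<beta> \<alpha>\<close> is \<open>\<beta> \<alpha>\<close>, defined when the target
  of \<open>\<alpha>\<close> is the source of \<open>\<beta>\<close>, and \<open>asc B \<gamma> \<beta> \<alpha> : \<gamma> (\<beta> \<alpha>) \<rightarrow> (\<gamma> \<beta>) \<alpha>\<close>.\<close>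

record ('a, 'h, 'c) bicat =
  cells0 :: "'a set"
  cells :: "('h, 'c) cat"
  src :: "'h \<Rightarrow> 'a"
  trg :: "'h \<Rightarrow> 'a"
  hid :: "'a \<Rightarrow> 'h"
  hcomp1 :: "'h \<Rightarrow> 'h \<Rightarrow> 'h"
  hcomp2 :: "'c \<Rightarrow> 'c \<Rightarrow> 'c"
  lun :: "'h \<Rightarrow> 'c"
  run :: "'h \<Rightarrow> 'c"
  asc :: "'h \<Rightarrow> 'h \<Rightarrow> 'h \<Rightarrow> 'c"

definition hom_cat :: "('a, 'h, 'c, 'z) bicat_scheme \<Rightarrow> 'a \<Rightarrow> 'a \<Rightarrow> ('h, 'c) cat" where
  "hom_cat B a b = (cells B)
    \<lparr>Obj := {\<alpha> \<in> Obj (cells B). src B \<alpha> = a \<and> trg B \<alpha> = b},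
     Mor := {\<phi> \<in> Mor (cells B). src B (Dom (cells B) \<phi>) = a \<and> trg B (Dom (cells B) \<phi>) = b}\<rparr>"

locale bicategory =
  fixes B :: "('a, 'h, 'c, 'z) bicat_scheme"
  assumes cells: "category (cells B)"
    and src_trg: "\<alpha> \<in> Obj (cells B) \<Longrightarrow> src B \<alpha> \<in> cells0 B \<and> trg B \<alpha> \<in> cells0 B"
    and parallel: "\<phi> \<in> Mor (cells B) \<Longrightarrow>
      src B (Dom (cells B) \<phi>) = src B (Cod (cells B) \<phi>) \<and>
      trg B (Dom (cells B) \<phi>) = trg B (Cod (cells B) \<phi>)"
    and hid: "a \<in> cells0 B \<Longrightarrow> hid B a \<in> Obj (hom_cat B a a)"
    and hcomp: "\<lbrakk>a \<in> cells0 B; b \<in> cells0 B; c \<in> cells0 B\<rbrakk> \<Longrightarrow>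
      is_functor (prod_cat (hom_cat B a b) (hom_cat B b c)) (hom_cat B a c)
        \<lparr>on_obj = (\<lambda>(\<alpha>, \<beta>). hcomp1 B \<beta> \<alpha>), on_mor = (\<lambda>(\<phi>, \<psi>). hcomp2 B \<psi> \<phi>)\<rparr>"
    and lun: "\<lbrakk>a \<in> cells0 B; b \<in> cells0 B\<rbrakk> \<Longrightarrow>
      natural_isomorphism (hom_cat B a b) (hom_cat B a b)
        \<lparr>on_obj = (\<lambda>\<alpha>. hcomp1 B (hid B b) \<alpha>),
         on_mor = (\<lambda>\<phi>. hcomp2 B (Ide (cells B) (hid B b)) \<phi>)\<rparr>
        id_map (lun B)"
    and run: "\<lbrakk>a \<in> cells0 B; b \<in> cells0 B\<rbrakk> \<Longrightarrow>
      natural_isomorphism (hom_cat B a b) (hom_cat B a b)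
        \<lparr>on_obj = (\<lambda>\<alpha>. hcomp1 B \<alpha> (hid B a)),
         on_mor = (\<lambda>\<phi>. hcomp2 B \<phi> (Ide (cells B) (hid B a)))\<rparr>
        id_map (run B)"
    and asc: "\<lbrakk>a \<in> cells0 B; b \<in> cells0 B; c \<in> cells0 B; d \<in> cells0 B\<rbrakk> \<Longrightarrow>
      natural_isomorphism
        (prod_cat (hom_cat B a b) (prod_cat (hom_cat B b c) (hom_cat B c d))) (hom_cat B a d)
        \<lparr>on_obj = (\<lambda>(\<alpha>, \<beta>, \<gamma>). hcomp1 B \<gamma> (hcomp1 B \<beta> \<alpha>)),
         on_mor = (\<lambda>(\<phi>, \<psi>, \<theta>). hcomp2 B \<theta> (hcomp2 B \<psi> \<phi>))\<rparr>
        \<lparr>on_obj = (\<lambda>(\<alpha>, \<beta>, \<gamma>). hcomp1 B (hcomp1 B \<gamma> \<beta>) \<alpha>),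
         on_mor = (\<lambda>(\<phi>, \<psi>, \<theta>). hcomp2 B (hcomp2 B \<theta> \<psi>) \<phi>)\<rparr>
        (\<lambda>(\<alpha>, \<beta>, \<gamma>). asc B \<gamma> \<beta> \<alpha>)"
    and triangle: "\<lbrakk>\<alpha> \<in> Obj (cells B); \<beta> \<in> Obj (cells B); trg B \<alpha> = src B \<beta>\<rbrakk> \<Longrightarrow>
      Cmp (cells B) (hcomp2 B (run B \<beta>) (Ide (cells B) \<alpha>)) (asc B \<beta> (hid B (trg B \<alpha>)) \<alpha>)
      = hcomp2 B (Ide (cells B) \<beta>) (lun B \<alpha>)"
    and pentagon: "\<lbrakk>\<alpha> \<in> Obj (cells B); \<beta> \<in> Obj (cells B); \<gamma> \<in> Obj (cells B); \<delta> \<in> Obj (cells B);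
        trg B \<alpha> = src B \<beta>; trg B \<beta> = src B \<gamma>; trg B \<gamma> = src B \<delta>\<rbrakk> \<Longrightarrow>
      Cmp (cells B) (asc B (hcomp1 B \<delta> \<gamma>) \<beta> \<alpha>) (asc B \<delta> \<gamma> (hcomp1 B \<beta> \<alpha>))
      = Cmp (cells B) (hcomp2 B (asc B \<delta> \<gamma> \<beta>) (Ide (cells B) \<alpha>))
          (Cmp (cells B) (asc B \<delta> (hcomp1 B \<gamma> \<beta>) \<alpha>)
            (hcomp2 B (Ide (cells B) \<delta>) (asc B \<gamma> \<beta> \<alpha>)))"

record ('a, 'h, 'c, 'f) dbicat = "('a, 'h, 'c) bicat" +
  deco :: "('a, 'f) cat"

locale decorated_bicategory = bicategory B
  for B :: "('a, 'h, 'c, 'f) dbicat" +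
  assumes deco: "category (deco B)"
    and deco_Obj: "Obj (deco B) = cells0 B"


section \<open>Double categories\<close>

text \<open>The pair \<open>(\<Phi>, \<Psi>)\<close> with \<open>t \<Phi> = s \<Psi>\<close> is sent by \<open>dhcomp\<close> to \<open>\<Psi> * \<Phi>\<close>.\<close>

record ('o, 'v, 'h, 'q) dcat =
  C0 :: "('o, 'v) cat"
  C1 :: "('h, 'q) cat"
  dsrc :: "('h, 'q, 'o, 'v) cat_map"
  dtrg :: "('h, 'q, 'o, 'v) cat_map"
  dhid :: "('o, 'v, 'h, 'q) cat_map"
  dhcomp :: "('h \<times> 'h, 'q \<times> 'q, 'h, 'q) cat_map"
  dlun :: "'h \<Rightarrow> 'q"
  drun :: "'h \<Rightarrow> 'q"
  dasc :: "'h \<Rightarrow> 'h \<Rightarrow> 'h \<Rightarrow> 'q"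

abbreviation hobj :: "('o, 'v, 'h, 'q) dcat \<Rightarrow> 'h \<Rightarrow> 'h \<Rightarrow> 'h" where
  "hobj D \<beta> \<alpha> \<equiv> on_obj (dhcomp D) (\<alpha>, \<beta>)"

abbreviation hsq :: "('o, 'v, 'h, 'q) dcat \<Rightarrow> 'q \<Rightarrow> 'q \<Rightarrow> 'q" where
  "hsq D \<Psi> \<Phi> \<equiv> on_mor (dhcomp D) (\<Phi>, \<Psi>)"

definition globular :: "('o, 'v, 'h, 'q) dcat \<Rightarrow> 'q \<Rightarrow> bool" where
  "globular D \<Phi> \<longleftrightarrow> \<Phi> \<in> Mor (C1 D) \<and>
     (\<exists>a \<in> Obj (C0 D). on_mor (dsrc D) \<Phi> = Ide (C0 D) a) \<and>
     (\<exists>b \<in> Obj (C0 D). on_mor (dtrg D) \<Phi> = Ide (C0 D) b)"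

definition composable2 :: "('o, 'v, 'h, 'q) dcat \<Rightarrow> ('h \<times> 'h, 'q \<times> 'q) cat" where
  "composable2 D = pullback (C1 D) (C1 D) (dtrg D) (dsrc D)"

definition composable3 :: "('o, 'v, 'h, 'q) dcat \<Rightarrow> ('h \<times> 'h \<times> 'h, 'q \<times> 'q \<times> 'q) cat" where
  "composable3 D = pullback (C1 D) (composable2 D) (dtrg D)
     \<lparr>on_obj = (\<lambda>(\<beta>, \<gamma>). on_obj (dsrc D) \<beta>), on_mor = (\<lambda>(\<Psi>, \<Theta>). on_mor (dsrc D) \<Psi>)\<rparr>"

locale double_category =
  fixes D :: "('o, 'v, 'h, 'q) dcat"
  assumes C0: "category (C0 D)"
    and C1: "category (C1 D)"
    and dsrc: "is_functor (C1 D) (C0 D) (dsrc D)"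
    and dtrg: "is_functor (C1 D) (C0 D) (dtrg D)"
    and dhid: "is_functor (C0 D) (C1 D) (dhid D)"
    and dhcomp: "is_functor (composable2 D) (C1 D) (dhcomp D)"
    and dhid_obj: "a \<in> Obj (C0 D) \<Longrightarrow>
      on_obj (dsrc D) (on_obj (dhid D) a) = a \<and> on_obj (dtrg D) (on_obj (dhid D) a) = a"
    and dhid_mor: "f \<in> Mor (C0 D) \<Longrightarrow>
      on_mor (dsrc D) (on_mor (dhid D) f) = f \<and> on_mor (dtrg D) (on_mor (dhid D) f) = f"
    and dhcomp_obj: "(\<alpha>, \<beta>) \<in> Obj (composable2 D) \<Longrightarrow>
      on_obj (dsrc D) (hobj D \<beta> \<alpha>) = on_obj (dsrc D) \<alpha> \<and>
      on_obj (dtrg D) (hobj D \<beta> \<alpha>) = on_obj (dtrg D) \<beta>"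
    and dhcomp_mor: "(\<Phi>, \<Psi>) \<in> Mor (composable2 D) \<Longrightarrow>
      on_mor (dsrc D) (hsq D \<Psi> \<Phi>) = on_mor (dsrc D) \<Phi> \<and>
      on_mor (dtrg D) (hsq D \<Psi> \<Phi>) = on_mor (dtrg D) \<Psi>"
    and dlun: "natural_isomorphism (C1 D) (C1 D)
      \<lparr>on_obj = (\<lambda>\<alpha>. hobj D (on_obj (dhid D) (on_obj (dtrg D) \<alpha>)) \<alpha>),
       on_mor = (\<lambda>\<Phi>. hsq D (on_mor (dhid D) (on_mor (dtrg D) \<Phi>)) \<Phi>)\<rparr>
      id_map (dlun D)"
    and drun: "natural_isomorphism (C1 D) (C1 D)
      \<lparr>on_obj = (\<lambda>\<alpha>. hobj D \<alpha> (on_obj (dhid D) (on_obj (dsrc D) \<alpha>))),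
       on_mor = (\<lambda>\<Phi>. hsq D \<Phi> (on_mor (dhid D) (on_mor (dsrc D) \<Phi>)))\<rparr>
      id_map (drun D)"
    and dasc: "natural_isomorphism (composable3 D) (C1 D)
      \<lparr>on_obj = (\<lambda>(\<alpha>, \<beta>, \<gamma>). hobj D \<gamma> (hobj D \<beta> \<alpha>)),
       on_mor = (\<lambda>(\<Phi>, \<Psi>, \<Theta>). hsq D \<Theta> (hsq D \<Psi> \<Phi>))\<rparr>
      \<lparr>on_obj = (\<lambda>(\<alpha>, \<beta>, \<gamma>). hobj D (hobj D \<gamma> \<beta>) \<alpha>),
       on_mor = (\<lambda>(\<Phi>, \<Psi>, \<Theta>). hsq D (hsq D \<Theta> \<Psi>) \<Phi>)\<rparr>
      (\<lambda>(\<alpha>, \<beta>, \<gamma>). dasc D \<gamma> \<beta> \<alpha>)"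
    and dlun_globular: "\<alpha> \<in> Obj (C1 D) \<Longrightarrow> globular D (dlun D \<alpha>)"
    and drun_globular: "\<alpha> \<in> Obj (C1 D) \<Longrightarrow> globular D (drun D \<alpha>)"
    and dasc_globular: "(\<alpha>, \<beta>, \<gamma>) \<in> Obj (composable3 D) \<Longrightarrow> globular D (dasc D \<gamma> \<beta> \<alpha>)"
    and triangle: "(\<alpha>, \<beta>) \<in> Obj (composable2 D) \<Longrightarrow>
      Cmp (C1 D) (hsq D (drun D \<beta>) (Ide (C1 D) \<alpha>))
        (dasc D \<beta> (on_obj (dhid D) (on_obj (dtrg D) \<alpha>)) \<alpha>)
      = hsq D (Ide (C1 D) \<beta>) (dlun D \<alpha>)"
    and pentagon: "\<lbrakk>(\<alpha>, \<beta>) \<in> Obj (composable2 D); (\<beta>, \<gamma>) \<in> Obj (composable2 D);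
        (\<gamma>, \<delta>) \<in> Obj (composable2 D)\<rbrakk> \<Longrightarrow>
      Cmp (C1 D) (dasc D (hobj D \<delta> \<gamma>) \<beta> \<alpha>) (dasc D \<delta> \<gamma> (hobj D \<beta> \<alpha>))
      = Cmp (C1 D) (hsq D (dasc D \<delta> \<gamma> \<beta>) (Ide (C1 D) \<alpha>))
          (Cmp (C1 D) (dasc D \<delta> (hobj D \<gamma> \<beta>) \<alpha>) (hsq D (Ide (C1 D) \<delta>) (dasc D \<gamma> \<beta> \<alpha>)))"

inductive_set generated_squares :: "('o, 'v, 'h, 'q) dcat \<Rightarrow> 'q set"
  for D :: "('o, 'v, 'h, 'q) dcat" where
  globular: "globular D \<Phi> \<Longrightarrow> \<Phi> \<in> generated_squares D"
| horizontal_identity: "f \<in> Mor (C0 D) \<Longrightarrow> on_mor (dhid D) f \<in> generated_squares D"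
| vertical: "\<lbrakk>\<Phi> \<in> generated_squares D; \<Psi> \<in> generated_squares D;
    Dom (C1 D) \<Psi> = Cod (C1 D) \<Phi>\<rbrakk> \<Longrightarrow> Cmp (C1 D) \<Psi> \<Phi> \<in> generated_squares D"
| horizontal: "\<lbrakk>\<Phi> \<in> generated_squares D; \<Psi> \<in> generated_squares D;
    on_mor (dtrg D) \<Phi> = on_mor (dsrc D) \<Psi>\<rbrakk> \<Longrightarrow> hsq D \<Psi> \<Phi> \<in> generated_squares D"

definition globularily_generated :: "('o, 'v, 'h, 'q) dcat \<Rightarrow> bool" where
  "globularily_generated D \<longleftrightarrow> Mor (C1 D) \<subseteq> generated_squares D"


section \<open>The free globularily generated construction\<close>

text \<open>Formal composites are represented so that the identifications made by the inclusions
  \<open>E k \<subseteq> Hom F k \<subseteq> E (k+1)\<close> hold literally. A formal composite \<open>Path \<alpha> [l\<^sub>1, \<dots>, l\<^sub>n]\<close> is a vertical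
  path with domain \<open>\<alpha>\<close>, listed in the order in which it is traversed (\<open>l\<^sub>1\<close> starts at \<open>\<alpha>\<close>); it is the
  empty path at \<open>\<alpha>\<close> if \<open>n = 0\<close>, and the same thing as \<open>l\<^sub>1\<close> if \<open>n = 1\<close>. Its steps are generators or
  words of length at least two, bracketed as \<open>HComp y x\<close>; a word of length one is its letter.
  A path of paths is flattened, so that the inclusion of \<open>F k\<close> in \<open>F (k+1)\<close> is a functor; a
  concatenation of words is the same thing as the word with these words as letters.\<close>

datatype ('h, 'c, 'f) path = Path 'h "('h, 'c, 'f) step list"
  and ('h, 'c, 'f) step =
    Cell 'c
  | HId 'f
  | HComp "('h, 'c, 'f) path" "('h, 'c, 'f) path"

primrec steps :: "('h, 'c, 'f) path \<Rightarrow> ('h, 'c, 'f) step list" where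
  "steps (Path \<alpha> ls) = ls"

primrec pdom :: "('h, 'c, 'f) path \<Rightarrow> 'h" where
  "pdom (Path \<alpha> ls) = \<alpha>"

primrec pcod :: "('a, 'h, 'c, 'f) dbicat \<Rightarrow> ('h, 'c, 'f) path \<Rightarrow> 'h"
  and step_cod :: "('a, 'h, 'c, 'f) dbicat \<Rightarrow> ('h, 'c, 'f) step \<Rightarrow> 'h" where
  "pcod B (Path \<alpha> ls) = last (\<alpha> # map (step_cod B) ls)"
| "step_cod B (Cell \<phi>) = Cod (cells B) \<phi>"
| "step_cod B (HId f) = hid B (Cod (deco B) f)"
| "step_cod B (HComp y x) = hcomp1 B (pcod B y) (pcod B x)"

text \<open>Source and target of a path are the composites in the decoration of those of its steps.\<close>

primrec psrc :: "('a, 'h, 'c, 'f) dbicat \<Rightarrow> ('h, 'c, 'f) path \<Rightarrow> 'f"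
  and step_src :: "('a, 'h, 'c, 'f) dbicat \<Rightarrow> ('h, 'c, 'f) step \<Rightarrow> 'f" where
  "psrc B (Path \<alpha> ls) =
     foldl (\<lambda>g f. Cmp (deco B) f g) (Ide (deco B) (src B \<alpha>)) (map (step_src B) ls)"
| "step_src B (Cell \<phi>) = Ide (deco B) (src B (Dom (cells B) \<phi>))"
| "step_src B (HId f) = f"
| "step_src B (HComp y x) = psrc B x"

primrec ptrg :: "('a, 'h, 'c, 'f) dbicat \<Rightarrow> ('h, 'c, 'f) path \<Rightarrow> 'f"
  and step_trg :: "('a, 'h, 'c, 'f) dbicat \<Rightarrow> ('h, 'c, 'f) step \<Rightarrow> 'f" where
  "ptrg B (Path \<alpha> ls) =
     foldl (\<lambda>g f. Cmp (deco B) f g) (Ide (deco B) (trg B \<alpha>)) (map (step_trg B) ls)"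
| "step_trg B (Cell \<phi>) = Ide (deco B) (trg B (Dom (cells B) \<phi>))"
| "step_trg B (HId f) = f"
| "step_trg B (HComp y x) = ptrg B y"

definition empty_path :: "'h \<Rightarrow> ('h, 'c, 'f) path" where
  "empty_path \<alpha> = Path \<alpha> []"

definition cell :: "('a, 'h, 'c, 'f) dbicat \<Rightarrow> 'c \<Rightarrow> ('h, 'c, 'f) path" where
  "cell B \<phi> = Path (Dom (cells B) \<phi>) [Cell \<phi>]"

definition hsym :: "('a, 'h, 'c, 'f) dbicat \<Rightarrow> 'f \<Rightarrow> ('h, 'c, 'f) path" where
  "hsym B f = Path (hid B (Dom (deco B) f)) [HId f]"

definition vcomp :: "('h, 'c, 'f) path \<Rightarrow> ('h, 'c, 'f) path \<Rightarrow> ('h, 'c, 'f) path" where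
  "vcomp y x = Path (pdom x) (steps x @ steps y)"

definition hconc ::
    "('a, 'h, 'c, 'f) dbicat \<Rightarrow> ('h, 'c, 'f) path \<Rightarrow> ('h, 'c, 'f) path \<Rightarrow> ('h, 'c, 'f) path" where
  "hconc B y x = Path (hcomp1 B (pdom y) (pdom x)) [HComp y x]"

definition generators :: "('a, 'h, 'c, 'f) dbicat \<Rightarrow> ('h, 'c, 'f) path set" where
  "generators B = cell B ` Mor (cells B) \<union> hsym B ` Mor (deco B)"

inductive_set parenthesized_words ::
    "('a, 'h, 'c, 'f) dbicat \<Rightarrow> ('h, 'c, 'f) path set \<Rightarrow> ('h, 'c, 'f) path set"
  for B :: "('a, 'h, 'c, 'f) dbicat" and X :: "('h, 'c, 'f) path set" where
  letter: "x \<in> X \<Longrightarrow> x \<in> parenthesized_words B X"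
| concat: "\<lbrakk>x \<in> parenthesized_words B X; y \<in> parenthesized_words B X; ptrg B x = psrc B y\<rbrakk> \<Longrightarrow>
    hconc B y x \<in> parenthesized_words B X"

inductive_set free_paths ::
    "('a, 'h, 'c, 'f) dbicat \<Rightarrow> ('h, 'c, 'f) path set \<Rightarrow> ('h, 'c, 'f) path set"
  for B :: "('a, 'h, 'c, 'f) dbicat" and X :: "('h, 'c, 'f) path set" where
  empty: "\<alpha> \<in> Obj (cells B) \<Longrightarrow> empty_path \<alpha> \<in> free_paths B X"
| extend: "\<lbrakk>p \<in> free_paths B X; x \<in> X; pdom x = pcod B p\<rbrakk> \<Longrightarrow> vcomp x p \<in> free_paths B X"

text \<open>\<open>E B k\<close> is the \<open>(k+1)\<close>-st stage: the numbering starts at \<open>0\<close>.\<close>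

primrec E :: "('a, 'h, 'c, 'f) dbicat \<Rightarrow> nat \<Rightarrow> ('h, 'c, 'f) path set" where
  "E B 0 = parenthesized_words B (generators B)"
| "E B (Suc k) = parenthesized_words B (free_paths B (E B k))"

definition E_inf :: "('a, 'h, 'c, 'f) dbicat \<Rightarrow> ('h, 'c, 'f) path set" where
  "E_inf B = (\<Union>k. E B k)"

definition F_inf :: "('a, 'h, 'c, 'f) dbicat \<Rightarrow> ('h, ('h, 'c, 'f) path) cat" where
  "F_inf B =
    \<lparr>Obj = Obj (cells B), Mor = E_inf B, Dom = pdom, Cod = pcod B, Ide = empty_path, Cmp = vcomp\<rparr>"

definition vdefined ::
    "('a, 'h, 'c, 'f) dbicat \<Rightarrow> ('h, 'c, 'f) path \<Rightarrow> ('h, 'c, 'f) path \<Rightarrow> bool" where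
  "vdefined B y x \<longleftrightarrow> x \<in> E_inf B \<and> y \<in> E_inf B \<and> pdom y = pcod B x"

definition hdefined ::
    "('a, 'h, 'c, 'f) dbicat \<Rightarrow> ('h, 'c, 'f) path \<Rightarrow> ('h, 'c, 'f) path \<Rightarrow> bool" where
  "hdefined B y x \<longleftrightarrow> x \<in> E_inf B \<and> y \<in> E_inf B \<and> ptrg B x = psrc B y"

text \<open>Vertical concatenation is strictly associative, so the bracketing of threefold vertical
  composites in the unit relations is immaterial.\<close>

inductive_set R_inf ::
    "('a, 'h, 'c, 'f) dbicat \<Rightarrow> (('h, 'c, 'f) path \<times> ('h, 'c, 'f) path) set"
  for B :: "('a, 'h, 'c, 'f) dbicat" where
  refl: "x \<in> E_inf B \<Longrightarrow> (x, x) \<in> R_inf B"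
| sym: "(x, y) \<in> R_inf B \<Longrightarrow> (y, x) \<in> R_inf B"
| trans: "\<lbrakk>(x, y) \<in> R_inf B; (y, z) \<in> R_inf B\<rbrakk> \<Longrightarrow> (x, z) \<in> R_inf B"
| vcomp_cong: "\<lbrakk>(x, x') \<in> R_inf B; (y, y') \<in> R_inf B; vdefined B y x; vdefined B y' x'\<rbrakk> \<Longrightarrow>
    (vcomp y x, vcomp y' x') \<in> R_inf B"
| hconc_cong: "\<lbrakk>(x, x') \<in> R_inf B; (y, y') \<in> R_inf B; hdefined B y x; hdefined B y' x'\<rbrakk> \<Longrightarrow>
    (hconc B y x, hconc B y' x') \<in> R_inf B"
| exchange: "\<lbrakk>hdefined B y2 y1; hdefined B x2 x1; vdefined B y2 x2; vdefined B y1 x1\<rbrakk> \<Longrightarrow>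
    (vcomp (hconc B y2 y1) (hconc B x2 x1), hconc B (vcomp y2 x2) (vcomp y1 x1)) \<in> R_inf B"
| vcomp_cell: "\<lbrakk>\<phi> \<in> Mor (cells B); \<psi> \<in> Mor (cells B); Dom (cells B) \<psi> = Cod (cells B) \<phi>\<rbrakk> \<Longrightarrow>
    (vcomp (cell B \<psi>) (cell B \<phi>), cell B (Cmp (cells B) \<psi> \<phi>)) \<in> R_inf B"
| vcomp_hsym: "\<lbrakk>f \<in> Mor (deco B); g \<in> Mor (deco B); Dom (deco B) g = Cod (deco B) f\<rbrakk> \<Longrightarrow>
    (vcomp (hsym B g) (hsym B f), hsym B (Cmp (deco B) g f)) \<in> R_inf B"
| ide_cell: "\<alpha> \<in> Obj (cells B) \<Longrightarrow> (empty_path \<alpha>, cell B (Ide (cells B) \<alpha>)) \<in> R_inf B"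
| ide_hsym: "a \<in> cells0 B \<Longrightarrow>
    (hsym B (Ide (deco B) a), cell B (Ide (cells B) (hid B a))) \<in> R_inf B"
| hconc_cell: "\<lbrakk>\<phi> \<in> Mor (cells B); \<psi> \<in> Mor (cells B);
      trg B (Dom (cells B) \<phi>) = src B (Dom (cells B) \<psi>)\<rbrakk> \<Longrightarrow>
    (hconc B (cell B \<psi>) (cell B \<phi>), cell B (hcomp2 B \<psi> \<phi>)) \<in> R_inf B"
| left_unit: "x \<in> E_inf B \<Longrightarrow>
    (x, vcomp (cell B (lun B (pcod B x)))
          (vcomp (hconc B (hsym B (ptrg B x)) x)
            (cell B (inv_mor (cells B) (lun B (pdom x)))))) \<in> R_inf B"
| right_unit: "x \<in> E_inf B \<Longrightarrow>
    (x, vcomp (cell B (run B (pcod B x)))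
          (vcomp (hconc B x (hsym B (psrc B x)))
            (cell B (inv_mor (cells B) (run B (pdom x)))))) \<in> R_inf B"
| assoc: "\<lbrakk>hdefined B y x; hdefined B z y\<rbrakk> \<Longrightarrow>
    (vcomp (cell B (asc B (pcod B z) (pcod B y) (pcod B x))) (hconc B z (hconc B y x)),
     vcomp (hconc B (hconc B z y) x) (cell B (asc B (pdom z) (pdom y) (pdom x)))) \<in> R_inf B"

definition V_inf :: "('a, 'h, 'c, 'f) dbicat \<Rightarrow> ('h, ('h, 'c, 'f) path set) cat" where
  "V_inf B = quotient_cat (F_inf B) (R_inf B)"

definition Q :: "('a, 'h, 'c, 'f) dbicat \<Rightarrow> ('a, 'f, 'h, ('h, 'c, 'f) path set) dcat" where
  "Q B =
    \<lparr>C0 = deco B,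
     C1 = V_inf B,
     dsrc = \<lparr>on_obj = src B, on_mor = (\<lambda>X. the_elem (psrc B ` X))\<rparr>,
     dtrg = \<lparr>on_obj = trg B, on_mor = (\<lambda>X. the_elem (ptrg B ` X))\<rparr>,
     dhid = \<lparr>on_obj = hid B, on_mor = (\<lambda>f. R_inf B `` {hsym B f})\<rparr>,
     dhcomp =
       \<lparr>on_obj = (\<lambda>(\<alpha>, \<beta>). hcomp1 B \<beta> \<alpha>),
        on_mor = (\<lambda>(X, Y). the_elem {R_inf B `` {hconc B y x} | x y. x \<in> X \<and> y \<in> Y})\<rparr>,
     dlun = (\<lambda>\<alpha>. R_inf B `` {cell B (lun B \<alpha>)}),
     drun = (\<lambda>\<alpha>. R_inf B `` {cell B (run B \<alpha>)}),
     dasc = (\<lambda>\<gamma> \<beta> \<alpha>. R_inf B `` {cell B (asc B \<gamma> \<beta> \<alpha>)})\<rparr>"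

end

(*
  A formal composite has well-defined boundaries in the cells and in the decoration, and every
  generating relation, hence the whole congruence, preserves them. So all structure maps descend to
  classes, and each axiom of a double category is read off a relation: functoriality of the
  horizontal composition is the exchange relation, naturality of the associator is relation (5), and
  naturality of the unitors is relation (4) after cancelling the inverse unitor. Relations (2) and (3)
  say that the cells of the bicategory embed compatibly with all compositions, which transports
  invertibility, triangle and pentagon. Generation is an induction on formal composites.
*)

theory Submission
  imports Defs
begin

section \<open>Categories and bicategories\<close>

text \<open>The stages \<open>E B k\<close> are an awkward basis for induction, since words and
  paths alternate and a composite may mix stages. They are replaced by the single closure
  \<open>formal\<close>. The inclusion of \<open>formal\<close> in \<open>E_inf B\<close> needs the
  stages to be nested, and a member \<open>x\<close> of a stage counts as a path of length one only
  if \<open>pdom x\<close> is known to be a 1-cell; hence boundaries are settled on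
  \<open>formal\<close> before the two sets are shown equal. The four boundaries have to be treated
  together: horizontal composability is an equation between morphisms of the decoration, and only
  their domains and codomains reveal that the underlying 1-cells are composable. Preservation of
  boundaries by the congruence does double duty: the congruence rules ask for definedness on both
  sides, so it also shows that a change of representatives keeps a composite defined. Functoriality
  of the composites that occur in the unitors and the associator is obtained formally: they are
  assembled from identities, horizontal identities and projections by pairing functors into a
  pullback.\<close>

lemma (in category) inv_mor_eq:
  assumes "inverse_of C f g"
  shows "inv_mor C f = g"
  unfolding inv_mor_def
proof (rule the_equality)
  fix h assume h: "inverse_of C f h"
  note fg = assms[unfolded inverse_of_def] and fh = h[unfolded inverse_of_def]
  have "h = Cmp C h (Cmp C f g)"
    using Cmp_Ide[of h] fg fh by simp
  also have "\<dots> = Cmp C (Cmp C h f) g"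
    using fg fh by (intro Cmp_assoc) auto
  also have "\<dots> = g"
    using Cmp_Ide[of g] fg fh by simp
  finally show "h = g" .
qed (rule assms)

lemma hom_cat_simps [simp]:
  "Obj (hom_cat B a b) = {\<alpha> \<in> Obj (cells B). src B \<alpha> = a \<and> trg B \<alpha> = b}"
  "Mor (hom_cat B a b) = {\<phi> \<in> Mor (cells B). src B (Dom (cells B) \<phi>) = a \<and> trg B (Dom (cells B) \<phi>) = b}"
  "Dom (hom_cat B a b) = Dom (cells B)"
  "Cod (hom_cat B a b) = Cod (cells B)"
  "Ide (hom_cat B a b) = Ide (cells B)"
  "Cmp (hom_cat B a b) = Cmp (cells B)"
  by (simp_all add: hom_cat_def)

lemma prod_cat_simps [simp]:
  "Obj (prod_cat C D) = Obj C \<times> Obj D"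
  "Mor (prod_cat C D) = Mor C \<times> Mor D"
  "Dom (prod_cat C D) (f, f') = (Dom C f, Dom D f')"
  "Cod (prod_cat C D) (f, f') = (Cod C f, Cod D f')"
  "Ide (prod_cat C D) (a, a') = (Ide C a, Ide D a')"
  "Cmp (prod_cat C D) (g, g') (f, f') = (Cmp C g f, Cmp D g' f')"
  by (simp_all add: prod_cat_def)

lemma pullback_simps [simp]:
  "Obj (pullback C D F G) = {(a, b). a \<in> Obj C \<and> b \<in> Obj D \<and> on_obj F a = on_obj G b}"
  "Mor (pullback C D F G) = {(f, g). f \<in> Mor C \<and> g \<in> Mor D \<and> on_mor F f = on_mor G g}"
  "Dom (pullback C D F G) (f, f') = (Dom C f, Dom D f')"
  "Cod (pullback C D F G) (f, f') = (Cod C f, Cod D f')"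
  "Ide (pullback C D F G) (a, a') = (Ide C a, Ide D a')"
  "Cmp (pullback C D F G) (g, g') (f, f') = (Cmp C g f, Cmp D g' f')"
  by (auto simp: pullback_def prod_cat_def)

text \<open>The matching condition survives identities and composites because \<open>F\<close> and
  \<open>G\<close> preserve them. It serves for composable pairs and again for composable
  triples.\<close>

lemma category_pullback:
  assumes "is_functor C K F" "is_functor D K G"
  shows "category (pullback C D F G)"
proof -
  interpret F: is_functor C K F by fact
  interpret G: is_functor D K G by fact
  show ?thesis
  proof
    fix p assume "p \<in> Mor (pullback C D F G)"
    then obtain f g where p: "p = (f, g)" "f \<in> Mor C" "g \<in> Mor D" "on_mor F f = on_mor G g"
      by auto
    show "Dom (pullback C D F G) p \<in> Obj (pullback C D F G) \<and>
        Cod (pullback C D F G) p \<in> Obj (pullback C D F G)"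
      using p F.C.Dom_Cod[of f] G.C.Dom_Cod[of g] F.on_mor[of f] G.on_mor[of g] by simp
    show "Cmp (pullback C D F G) p (Ide (pullback C D F G) (Dom (pullback C D F G) p)) = p \<and>
        Cmp (pullback C D F G) (Ide (pullback C D F G) (Cod (pullback C D F G) p)) p = p"
      using p F.C.Cmp_Ide[of f] G.C.Cmp_Ide[of g] by simp
  next
    fix a assume "a \<in> Obj (pullback C D F G)"
    then show "Ide (pullback C D F G) a \<in> Mor (pullback C D F G) \<and>
        Dom (pullback C D F G) (Ide (pullback C D F G) a) = a \<and>
        Cod (pullback C D F G) (Ide (pullback C D F G) a) = a"
      using F.C.Ide G.C.Ide F.on_Ide G.on_Ide by auto
  next
    fix p q
    assume "p \<in> Mor (pullback C D F G)" "q \<in> Mor (pullback C D F G)"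
      "Dom (pullback C D F G) q = Cod (pullback C D F G) p"
    then show "Cmp (pullback C D F G) q p \<in> Mor (pullback C D F G) \<and>
        Dom (pullback C D F G) (Cmp (pullback C D F G) q p) = Dom (pullback C D F G) p \<and>
        Cod (pullback C D F G) (Cmp (pullback C D F G) q p) = Cod (pullback C D F G) q"
      using F.C.Cmp G.C.Cmp F.on_Cmp G.on_Cmp by auto
  next
    fix p q r
    assume "p \<in> Mor (pullback C D F G)" "q \<in> Mor (pullback C D F G)" "r \<in> Mor (pullback C D F G)"
      "Dom (pullback C D F G) q = Cod (pullback C D F G) p"
      "Dom (pullback C D F G) r = Cod (pullback C D F G) q"
    then show "Cmp (pullback C D F G) r (Cmp (pullback C D F G) q p) =
        Cmp (pullback C D F G) (Cmp (pullback C D F G) r q) p"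
      using F.C.Cmp_assoc G.C.Cmp_assoc by auto
  qed
qed

text \<open>Reassociation brings \<open>l'\<close> next to \<open>l\<close>, where the two cancel.
  With \<open>l\<close> and \<open>m\<close> the unitors at the domain and the codomain of a square,
  this turns a unit relation, which writes the square as a conjugate, into a naturality
  equation.\<close>

lemma (in category) conjugate_square:
  assumes "inverse_of C l l'" "h \<in> Mor C" "m \<in> Mor C" "Dom C h = Dom C l" "Dom C m = Cod C h"
  shows "Cmp C (Cmp C m (Cmp C h l')) l = Cmp C m h"
proof -
  note l = assms(1)[unfolded inverse_of_def]
  have "Cmp C (Cmp C m (Cmp C h l')) l = Cmp C (Cmp C (Cmp C m h) l') l"
    using l assms by (subst Cmp_assoc) auto
  also have "\<dots> = Cmp C (Cmp C m h) (Cmp C l' l)"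
    using l assms Cmp[of h m] by (subst Cmp_assoc[of l]) auto
  also have "\<dots> = Cmp C m h"
    using l assms Cmp[of h m] Cmp_Ide[of "Cmp C m h"] by auto
  finally show ?thesis .
qed

section \<open>Composition and pairing of functors\<close>

lemma is_functor_id_map: "category C \<Longrightarrow> is_functor C C id_map"
  by (simp add: is_functor_def is_functor_axioms_def id_map_def)

lemma is_functor_compose:
  assumes "is_functor C D F" "is_functor D K G"
  shows "is_functor C K \<lparr>on_obj = (\<lambda>a. on_obj G (on_obj F a)), on_mor = (\<lambda>f. on_mor G (on_mor F f))\<rparr>"
proof -
  interpret F: is_functor C D F by fact
  interpret G: is_functor D K G by fact
  show ?thesis
    by unfold_locales (simp_all add: F.on_obj G.on_obj F.on_mor G.on_mor F.on_Ide G.on_Ide F.on_Cmp G.on_Cmp)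
qed

text \<open>Agreement over \<open>S\<close> and \<open>T\<close> places every pair in the pullback,
  so this is the induced functor followed by \<open>H\<close>.\<close>

lemma is_functor_pairing:
  assumes "is_functor X C F" "is_functor X D G" "is_functor (pullback C D S T) K H"
    and obj: "\<And>a. a \<in> Obj X \<Longrightarrow> on_obj S (on_obj F a) = on_obj T (on_obj G a)"
    and mor: "\<And>f. f \<in> Mor X \<Longrightarrow> on_mor S (on_mor F f) = on_mor T (on_mor G f)"
  shows "is_functor X K \<lparr>on_obj = (\<lambda>a. on_obj H (on_obj F a, on_obj G a)),
    on_mor = (\<lambda>f. on_mor H (on_mor F f, on_mor G f))\<rparr>"
    (is "is_functor X K ?FG")
proof -
  interpret F: is_functor X C F by fact
  interpret G: is_functor X D G by fact
  interpret H: is_functor "pullback C D S T" K H by fact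
  show ?thesis
  proof
    fix a assume a: "a \<in> Obj X"
    then have p: "(on_obj F a, on_obj G a) \<in> Obj (pullback C D S T)"
      using obj by (simp add: F.on_obj G.on_obj)
    show "on_obj ?FG a \<in> Obj K"
      using H.on_obj[OF p] by simp
    show "on_mor ?FG (Ide X a) = Ide K (on_obj ?FG a)"
      using a H.on_Ide[OF p] by (simp add: F.on_Ide G.on_Ide)
  next
    fix f assume f: "f \<in> Mor X"
    then have p: "(on_mor F f, on_mor G f) \<in> Mor (pullback C D S T)"
      using mor by (simp add: F.on_mor G.on_mor)
    show "on_mor ?FG f \<in> Mor K \<and>
        Dom K (on_mor ?FG f) = on_obj ?FG (Dom X f) \<and>
        Cod K (on_mor ?FG f) = on_obj ?FG (Cod X f)"
      using f H.on_mor[OF p] by (simp add: F.on_mor G.on_mor)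
  next
    fix f g assume fg: "f \<in> Mor X" "g \<in> Mor X" "Dom X g = Cod X f"
    then have "(on_mor F f, on_mor G f) \<in> Mor (pullback C D S T)"
      "(on_mor F g, on_mor G g) \<in> Mor (pullback C D S T)"
      using mor by (simp_all add: F.on_mor G.on_mor)
    from H.on_Cmp[OF this] show "on_mor ?FG (Cmp X g f) =
        Cmp K (on_mor ?FG g) (on_mor ?FG f)"
      using fg by (simp add: F.on_mor G.on_mor F.on_Cmp G.on_Cmp)
  qed
qed

section \<open>Boundaries and inverses of the structure cells of a bicategory\<close>

context bicategory
begin

interpretation K: category "cells B" by (rule cells)

lemma hid_Obj:
  assumes "a \<in> cells0 B"
  shows "hid B a \<in> Obj (cells B)" "src B (hid B a) = a" "trg B (hid B a) = a"
  using hid[OF assms] by auto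

lemma hcomp1_Obj:
  assumes "\<alpha> \<in> Obj (cells B)" "\<beta> \<in> Obj (cells B)" "trg B \<alpha> = src B \<beta>"
  shows "hcomp1 B \<beta> \<alpha> \<in> Obj (cells B)" "src B (hcomp1 B \<beta> \<alpha>) = src B \<alpha>"
    "trg B (hcomp1 B \<beta> \<alpha>) = trg B \<beta>"
  using is_functor.on_obj[OF hcomp[of "src B \<alpha>" "trg B \<alpha>" "trg B \<beta>"], of "(\<alpha>, \<beta>)"] assms src_trg
  by auto

lemma hcomp2_Mor:
  assumes "\<phi> \<in> Mor (cells B)" "\<psi> \<in> Mor (cells B)"
    and "trg B (Dom (cells B) \<phi>) = src B (Dom (cells B) \<psi>)"
  shows "hcomp2 B \<psi> \<phi> \<in> Mor (cells B)"
    "Dom (cells B) (hcomp2 B \<psi> \<phi>) = hcomp1 B (Dom (cells B) \<psi>) (Dom (cells B) \<phi>)"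
    "Cod (cells B) (hcomp2 B \<psi> \<phi>) = hcomp1 B (Cod (cells B) \<psi>) (Cod (cells B) \<phi>)"
  using is_functor.on_mor[OF hcomp[of "src B (Dom (cells B) \<phi>)" "trg B (Dom (cells B) \<phi>)"
        "trg B (Dom (cells B) \<psi>)"], of "(\<phi>, \<psi>)"] assms src_trg K.Dom_Cod
  by auto

lemma hcomp2_Ide:
  assumes "\<alpha> \<in> Obj (cells B)" "\<beta> \<in> Obj (cells B)" "trg B \<alpha> = src B \<beta>"
  shows "hcomp2 B (Ide (cells B) \<beta>) (Ide (cells B) \<alpha>) = Ide (cells B) (hcomp1 B \<beta> \<alpha>)"
  using is_functor.on_Ide[OF hcomp[of "src B \<alpha>" "trg B \<alpha>" "trg B \<beta>"], of "(\<alpha>, \<beta>)"] assms src_trg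
  by auto

text \<open>A hom-category takes all its operations from \<open>cells B\<close> and restricts only
  the carriers.\<close>

lemma inverse_of_hom_cat: "inverse_of (hom_cat B a b) f g \<Longrightarrow> inverse_of (cells B) f g"
  by (auto simp: inverse_of_def)

lemma lun_iso:
  assumes "\<alpha> \<in> Obj (cells B)"
  shows "lun B \<alpha> \<in> Mor (cells B)"
    "Dom (cells B) (lun B \<alpha>) = hcomp1 B (hid B (trg B \<alpha>)) \<alpha>"
    "Cod (cells B) (lun B \<alpha>) = \<alpha>"
    "inverse_of (cells B) (lun B \<alpha>) (inv_mor (cells B) (lun B \<alpha>))"
proof -
  interpret N: natural_isomorphism "hom_cat B (src B \<alpha>) (trg B \<alpha>)" "hom_cat B (src B \<alpha>) (trg B \<alpha>)"
    "\<lparr>on_obj = (\<lambda>\<gamma>. hcomp1 B (hid B (trg B \<alpha>)) \<gamma>),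
      on_mor = (\<lambda>\<phi>. hcomp2 B (Ide (cells B) (hid B (trg B \<alpha>))) \<phi>)\<rparr>" id_map "lun B"
    using assms src_trg by (intro lun) auto
  show "lun B \<alpha> \<in> Mor (cells B)" "Dom (cells B) (lun B \<alpha>) = hcomp1 B (hid B (trg B \<alpha>)) \<alpha>"
    "Cod (cells B) (lun B \<alpha>) = \<alpha>"
    using N.component[of \<alpha>] assms by (auto simp: id_map_def)
  \<comment> \<open>\<open>inv_mor\<close> is a definite description; uniqueness of inverses
    identifies it with the inverse that the natural isomorphism provides.\<close>
  show "inverse_of (cells B) (lun B \<alpha>) (inv_mor (cells B) (lun B \<alpha>))"
    using N.invertible[of \<alpha>] assms by (auto dest!: inverse_of_hom_cat simp: K.inv_mor_eq)
qed

lemma run_iso: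
  assumes "\<alpha> \<in> Obj (cells B)"
  shows "run B \<alpha> \<in> Mor (cells B)"
    "Dom (cells B) (run B \<alpha>) = hcomp1 B \<alpha> (hid B (src B \<alpha>))"
    "Cod (cells B) (run B \<alpha>) = \<alpha>"
    "inverse_of (cells B) (run B \<alpha>) (inv_mor (cells B) (run B \<alpha>))"
proof -
  interpret N: natural_isomorphism "hom_cat B (src B \<alpha>) (trg B \<alpha>)" "hom_cat B (src B \<alpha>) (trg B \<alpha>)"
    "\<lparr>on_obj = (\<lambda>\<gamma>. hcomp1 B \<gamma> (hid B (src B \<alpha>))),
      on_mor = (\<lambda>\<phi>. hcomp2 B \<phi> (Ide (cells B) (hid B (src B \<alpha>))))\<rparr>" id_map "run B"
    using assms src_trg by (intro run) auto
  show "run B \<alpha> \<in> Mor (cells B)" "Dom (cells B) (run B \<alpha>) = hcomp1 B \<alpha> (hid B (src B \<alpha>))"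
    "Cod (cells B) (run B \<alpha>) = \<alpha>"
    using N.component[of \<alpha>] assms by (auto simp: id_map_def)
  show "inverse_of (cells B) (run B \<alpha>) (inv_mor (cells B) (run B \<alpha>))"
    using N.invertible[of \<alpha>] assms by (auto dest!: inverse_of_hom_cat simp: K.inv_mor_eq)
qed

lemma asc_iso:
  assumes "\<alpha> \<in> Obj (cells B)" "\<beta> \<in> Obj (cells B)" "\<gamma> \<in> Obj (cells B)"
    and "trg B \<alpha> = src B \<beta>" "trg B \<beta> = src B \<gamma>"
  shows "asc B \<gamma> \<beta> \<alpha> \<in> Mor (cells B)"
    "Dom (cells B) (asc B \<gamma> \<beta> \<alpha>) = hcomp1 B \<gamma> (hcomp1 B \<beta> \<alpha>)"
    "Cod (cells B) (asc B \<gamma> \<beta> \<alpha>) = hcomp1 B (hcomp1 B \<gamma> \<beta>) \<alpha>"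
    "\<exists>g. inverse_of (cells B) (asc B \<gamma> \<beta> \<alpha>) g"
proof -
  have "src B \<alpha> \<in> cells0 B" "trg B \<alpha> \<in> cells0 B" "trg B \<beta> \<in> cells0 B" "trg B \<gamma> \<in> cells0 B"
    using assms src_trg by auto
  note N = asc[OF this]
  show "asc B \<gamma> \<beta> \<alpha> \<in> Mor (cells B)"
    "Dom (cells B) (asc B \<gamma> \<beta> \<alpha>) = hcomp1 B \<gamma> (hcomp1 B \<beta> \<alpha>)"
    "Cod (cells B) (asc B \<gamma> \<beta> \<alpha>) = hcomp1 B (hcomp1 B \<gamma> \<beta>) \<alpha>"
    using natural_isomorphism.component[OF N, of "(\<alpha>, \<beta>, \<gamma>)"] assms by auto
  show "\<exists>g. inverse_of (cells B) (asc B \<gamma> \<beta> \<alpha>) g"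
    using natural_isomorphism.invertible[OF N, of "(\<alpha>, \<beta>, \<gamma>)"] assms
    by (auto dest!: inverse_of_hom_cat)
qed

end

section \<open>Formal composites\<close>

lemma steps_vcomp [simp]: "steps (vcomp y x) = steps x @ steps y"
  by (simp add: vcomp_def)

lemma pdom_simps [simp]:
  "pdom (vcomp y x) = pdom x"
  "pdom (empty_path \<alpha>) = \<alpha>"
  "pdom (cell B \<phi>) = Dom (cells B) \<phi>"
  "pdom (hsym B f) = hid B (Dom (deco B) f)"
  "pdom (hconc B y x) = hcomp1 B (pdom y) (pdom x)"
  by (simp_all add: vcomp_def empty_path_def cell_def hsym_def hconc_def)

lemma pcod_simps [simp]:
  "pcod B (empty_path \<alpha>) = \<alpha>"
  "pcod B (cell B \<phi>) = Cod (cells B) \<phi>"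
  "pcod B (hsym B f) = hid B (Cod (deco B) f)"
  "pcod B (hconc B y x) = hcomp1 B (pcod B y) (pcod B x)"
  by (simp_all add: empty_path_def cell_def hsym_def hconc_def)

text \<open>The hypothesis matters when \<open>y\<close> is empty: its codomain is then its own
  domain, whereas the composite ends where \<open>x\<close> ends.\<close>

lemma pcod_vcomp [simp]: "pdom y = pcod B x \<Longrightarrow> pcod B (vcomp y x) = pcod B y"
  by (cases x; cases y) (simp add: vcomp_def)

text \<open>\<open>vcomp\<close> reads only the steps of its first argument, so the second equation
  holds for every \<alpha>.\<close>

lemma vcomp_empty [simp]: "vcomp x (empty_path (pdom x)) = x" "vcomp (empty_path \<alpha>) x = x"
  by (cases x; simp add: vcomp_def empty_path_def)+

lemma vcomp_assoc: "vcomp z (vcomp y x) = vcomp (vcomp z y) x"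
  by (simp add: vcomp_def)

text \<open>A description of the formal composites without stages. Empty paths need a clause of
  their own: they are not composites of generators, and only the congruence identifies them with
  identity cells.\<close>

inductive_set formal :: "('a, 'h, 'c, 'f) dbicat \<Rightarrow> ('h, 'c, 'f) path set"
  for B :: "('a, 'h, 'c, 'f) dbicat" where
  formal_empty: "\<alpha> \<in> Obj (cells B) \<Longrightarrow> empty_path \<alpha> \<in> formal B"
| formal_cell: "\<phi> \<in> Mor (cells B) \<Longrightarrow> cell B \<phi> \<in> formal B"
| formal_hsym: "f \<in> Mor (deco B) \<Longrightarrow> hsym B f \<in> formal B"
| formal_vcomp: "\<lbrakk>x \<in> formal B; y \<in> formal B; pdom y = pcod B x\<rbrakk> \<Longrightarrow> vcomp y x \<in> formal B"
| formal_hconc: "\<lbrakk>x \<in> formal B; y \<in> formal B; ptrg B x = psrc B y\<rbrakk> \<Longrightarrow> hconc B y x \<in> formal B"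

lemma parenthesized_words_subset_formal:
  assumes "X \<subseteq> formal B"
  shows "parenthesized_words B X \<subseteq> formal B"
proof
  fix x assume "x \<in> parenthesized_words B X"
  then show "x \<in> formal B"
    by induction (use assms in \<open>auto intro: formal_hconc\<close>)
qed

lemma free_paths_subset_formal:
  assumes "X \<subseteq> formal B"
  shows "free_paths B X \<subseteq> formal B"
proof
  fix x assume "x \<in> free_paths B X"
  then show "x \<in> formal B"
    by induction (use assms in \<open>auto intro: formal_empty formal_vcomp\<close>)
qed

lemma E_subset_formal: "E B k \<subseteq> formal B"
proof (induction k)
  case 0
  have "generators B \<subseteq> formal B"
    by (auto simp: generators_def intro: formal_cell formal_hsym)
  then show ?case
    by (simp add: parenthesized_words_subset_formal)
qed (simp add: parenthesized_words_subset_formal free_paths_subset_formal)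

section \<open>Boundaries of formal composites in the cells and in the decoration\<close>

context decorated_bicategory
begin

interpretation K: category "cells B" by (rule cells)
interpretation D: category "deco B" by (rule deco)

lemma hid_Dom_Cod:
  assumes "f \<in> Mor (deco B)"
  shows "hid B (Dom (deco B) f) \<in> Obj (cells B)" "hid B (Cod (deco B) f) \<in> Obj (cells B)"
    "src B (hid B (Dom (deco B) f)) = Dom (deco B) f" "src B (hid B (Cod (deco B) f)) = Cod (deco B) f"
    "trg B (hid B (Dom (deco B) f)) = Dom (deco B) f" "trg B (hid B (Cod (deco B) f)) = Cod (deco B) f"
  using D.Dom_Cod[OF assms] by (auto simp: deco_Obj hid_Obj)

text \<open>A path is recorded together with the action of its steps on an arbitrary composable
  morphism of the decoration, since \<open>psrc\<close> and \<open>ptrg\<close> fold from the left.\<close>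

definition well_bounded :: "('h, 'c, 'f) path \<Rightarrow> bool" where
  "well_bounded x \<longleftrightarrow>
     pdom x \<in> Obj (cells B) \<and> pcod B x \<in> Obj (cells B) \<and>
     psrc B x \<in> Mor (deco B) \<and>
     Dom (deco B) (psrc B x) = src B (pdom x) \<and> Cod (deco B) (psrc B x) = src B (pcod B x) \<and>
     ptrg B x \<in> Mor (deco B) \<and>
     Dom (deco B) (ptrg B x) = trg B (pdom x) \<and> Cod (deco B) (ptrg B x) = trg B (pcod B x) \<and>
     (\<forall>g \<in> Mor (deco B). Cod (deco B) g = src B (pdom x) \<longrightarrow>
        foldl (\<lambda>g f. Cmp (deco B) f g) g (map (step_src B) (steps x)) = Cmp (deco B) (psrc B x) g) \<and>
     (\<forall>g \<in> Mor (deco B). Cod (deco B) g = trg B (pdom x) \<longrightarrow>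
        foldl (\<lambda>g f. Cmp (deco B) f g) g (map (step_trg B) (steps x)) = Cmp (deco B) (ptrg B x) g)"

lemma Ide_deco:
  assumes "a \<in> cells0 B"
  shows "Ide (deco B) a \<in> Mor (deco B)" "Dom (deco B) (Ide (deco B) a) = a"
    "Cod (deco B) (Ide (deco B) a) = a" "Cmp (deco B) (Ide (deco B) a) (Ide (deco B) a) = Ide (deco B) a"
  using D.Ide[of a] D.Cmp_Ide[of "Ide (deco B) a"] assms by (auto simp: deco_Obj)

lemma Cmp_Ide_deco:
  assumes "f \<in> Mor (deco B)"
  shows "Dom (deco B) f = a \<Longrightarrow> Cmp (deco B) f (Ide (deco B) a) = f"
    "Cod (deco B) f = a \<Longrightarrow> Cmp (deco B) (Ide (deco B) a) f = f"
  using D.Cmp_Ide assms by auto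

lemma psrc_eq: "psrc B x =
    foldl (\<lambda>g f. Cmp (deco B) f g) (Ide (deco B) (src B (pdom x))) (map (step_src B) (steps x))"
  by (cases x) simp

lemma ptrg_eq: "ptrg B x =
    foldl (\<lambda>g f. Cmp (deco B) f g) (Ide (deco B) (trg B (pdom x))) (map (step_trg B) (steps x))"
  by (cases x) simp

lemma psrc_vcomp_foldl:
  "psrc B (vcomp y x) = foldl (\<lambda>g f. Cmp (deco B) f g) (psrc B x) (map (step_src B) (steps y))"
  by (simp add: psrc_eq)

lemma ptrg_vcomp_foldl:
  "ptrg B (vcomp y x) = foldl (\<lambda>g f. Cmp (deco B) f g) (ptrg B x) (map (step_trg B) (steps y))"
  by (simp add: ptrg_eq)

text \<open>The fold behind \<open>psrc\<close> and \<open>ptrg\<close> starts from an identity, so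
  even a single step leaves a composite with that identity, which a unit law removes.\<close>

lemma psrc_cell:
  assumes "\<phi> \<in> Mor (cells B)"
  shows "psrc B (cell B \<phi>) = Ide (deco B) (src B (Dom (cells B) \<phi>))"
    "ptrg B (cell B \<phi>) = Ide (deco B) (trg B (Dom (cells B) \<phi>))"
  using K.Dom_Cod[OF assms] src_trg[of "Dom (cells B) \<phi>"] by (auto simp: cell_def Ide_deco)

lemma psrc_hsym:
  assumes "f \<in> Mor (deco B)"
  shows "psrc B (hsym B f) = f" "ptrg B (hsym B f) = f"
  using assms by (auto simp: hsym_def Cmp_Ide_deco hid_Dom_Cod)

lemma well_bounded_hconc:
  assumes x: "well_bounded x" and y: "well_bounded y" and t: "ptrg B x = psrc B y"
  shows "well_bounded (hconc B y x) \<and> psrc B (hconc B y x) = psrc B x \<and> ptrg B (hconc B y x) = ptrg B y"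
proof -
  note wx = x[unfolded well_bounded_def] and wy = y[unfolded well_bounded_def]
  \<comment> \<open>Domain and codomain of the decoration morphism
    \<open>ptrg B x = psrc B y\<close>, computed from both sides.\<close>
  have [simp]: "trg B (pdom x) = src B (pdom y)" "trg B (pcod B x) = src B (pcod B y)"
    using wx wy t by metis+
  have p: "psrc B (hconc B y x) = psrc B x" "ptrg B (hconc B y x) = ptrg B y"
    using wx wy by (auto simp: hconc_def hcomp1_Obj Cmp_Ide_deco)
  moreover have "well_bounded (hconc B y x)"
    unfolding well_bounded_def p using wx wy by (auto simp: hcomp1_Obj) (auto simp: hconc_def)
  ultimately show ?thesis by simp
qed

text \<open>Folding over the steps of \<open>x\<close> leaves \<open>psrc B x\<close> (or
  \<open>ptrg B x\<close>) as the accumulator for those of \<open>y\<close>, so the accumulator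
  clause for \<open>y\<close> applies to it. The clause for the composite then follows by
  associativity in the decoration.\<close>

lemma well_bounded_vcomp:
  assumes x: "well_bounded x" and y: "well_bounded y" and t: "pdom y = pcod B x"
  shows "well_bounded (vcomp y x) \<and> psrc B (vcomp y x) = Cmp (deco B) (psrc B y) (psrc B x) \<and>
    ptrg B (vcomp y x) = Cmp (deco B) (ptrg B y) (ptrg B x)"
proof -
  note wx = x[unfolded well_bounded_def] and wy = y[unfolded well_bounded_def]
  have p: "psrc B (vcomp y x) = Cmp (deco B) (psrc B y) (psrc B x)"
    "ptrg B (vcomp y x) = Cmp (deco B) (ptrg B y) (ptrg B x)"
    unfolding psrc_vcomp_foldl ptrg_vcomp_foldl using wx wy t by auto
  moreover have "well_bounded (vcomp y x)"
    unfolding well_bounded_def p pdom_simps pcod_vcomp[OF t] using wx wy t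
    by (auto simp: D.Cmp D.Cmp_assoc)
  ultimately show ?thesis by simp
qed

lemma formal_well_bounded: "x \<in> formal B \<Longrightarrow> well_bounded x"
proof (induction rule: formal.induct)
  case (formal_empty \<alpha>)
  then show ?case
    using src_trg[of \<alpha>] by (auto simp: well_bounded_def empty_path_def Ide_deco Cmp_Ide_deco)
next
  case (formal_cell \<phi>)
  then show ?case
    using K.Dom_Cod[of \<phi>] src_trg parallel[of \<phi>]
    by (auto simp: well_bounded_def psrc_cell Ide_deco) (auto simp: cell_def)
next
  case (formal_hsym f)
  then show ?case
    by (auto simp: well_bounded_def psrc_hsym hid_Dom_Cod) (auto simp: hsym_def)
qed (use well_bounded_hconc well_bounded_vcomp in auto)

text \<open>\<open>x\<close> extends the empty path at its own domain by one step. That empty path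
  is available because well-boundedness makes \<open>pdom x\<close> a 1-cell.\<close>

lemma E_subset_free_paths: "x \<in> E B k \<Longrightarrow> x \<in> free_paths B (E B k)"
  using free_paths.extend[OF free_paths.empty, of "pdom x" B x "E B k"]
    formal_well_bounded[of x] E_subset_formal[of B k] by (auto simp: well_bounded_def)

text \<open>A stage enters the next one as paths of length one, taken as words of length
  one.\<close>

lemma E_mono: "k \<le> l \<Longrightarrow> E B k \<subseteq> E B l"
  by (induction rule: dec_induct) (auto dest: subsetD intro!: parenthesized_words.letter E_subset_free_paths)

lemma free_paths_vcomp:
  assumes "y \<in> free_paths B X" "x \<in> free_paths B X" "pdom y = pcod B x"
  shows "vcomp y x \<in> free_paths B X"
  using assms
proof (induction)
  \<comment> \<open>Reassociation makes \<open>z\<close> the outermost factor, as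
    \<open>free_paths.extend\<close> requires.\<close>
  case (extend p z)
  then show ?case
    by (auto simp flip: vcomp_assoc intro!: free_paths.extend)
qed simp

text \<open>Composition costs one stage: both factors are raised to stage \<open>max k l\<close>; a
  vertical composite is then a path over that stage, a horizontal one a word in its paths, and
  either belongs to the next stage.\<close>

lemma E_inf_eq_formal: "E_inf B = formal B"
proof
  show "E_inf B \<subseteq> formal B"
    using E_subset_formal by (auto simp: E_inf_def)
  show "formal B \<subseteq> E_inf B"
  proof
    fix x assume "x \<in> formal B"
    then show "x \<in> E_inf B"
    proof induction
      case (formal_empty \<alpha>)
      \<comment> \<open>Stage 0 consists of words in generators, so empty paths first occur one
        stage later.\<close>
      then have "empty_path \<alpha> \<in> E B 1"
        by (auto intro: parenthesized_words.letter free_paths.empty)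
      then show ?case unfolding E_inf_def by blast
    next
      case (formal_cell \<phi>)
      then have "cell B \<phi> \<in> E B 0"
        by (auto intro: parenthesized_words.letter simp: generators_def)
      then show ?case unfolding E_inf_def by blast
    next
      case (formal_hsym f)
      then have "hsym B f \<in> E B 0"
        by (auto intro: parenthesized_words.letter simp: generators_def)
      then show ?case unfolding E_inf_def by blast
    next
      case (formal_vcomp x y)
      then obtain k l where "x \<in> E B k" "y \<in> E B l"
        by (auto simp: E_inf_def)
      then have "x \<in> E B (max k l)" "y \<in> E B (max k l)"
        using E_mono[of k "max k l"] E_mono[of l "max k l"] by auto
      then have "vcomp y x \<in> free_paths B (E B (max k l))"
        using formal_vcomp by (intro free_paths_vcomp E_subset_free_paths)
      then have "vcomp y x \<in> E B (Suc (max k l))"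
        by (simp add: parenthesized_words.letter)
      then show ?case unfolding E_inf_def by blast
    next
      case (formal_hconc x y)
      then obtain k l where "x \<in> E B k" "y \<in> E B l"
        by (auto simp: E_inf_def)
      then have "x \<in> free_paths B (E B (max k l))" "y \<in> free_paths B (E B (max k l))"
        using E_mono[of k "max k l"] E_mono[of l "max k l"] E_subset_free_paths by auto
      then have "hconc B y x \<in> E B (Suc (max k l))"
        using formal_hconc by (simp add: parenthesized_words.letter parenthesized_words.concat)
      then show ?case unfolding E_inf_def by blast
    qed
  qed
qed

lemma E_inf_boundary:
  assumes "x \<in> E_inf B"
  shows "pdom x \<in> Obj (cells B)" "pcod B x \<in> Obj (cells B)"
    "psrc B x \<in> Mor (deco B)" "ptrg B x \<in> Mor (deco B)"
    "Dom (deco B) (psrc B x) = src B (pdom x)" "Cod (deco B) (psrc B x) = src B (pcod B x)"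
    "Dom (deco B) (ptrg B x) = trg B (pdom x)" "Cod (deco B) (ptrg B x) = trg B (pcod B x)"
  using formal_well_bounded[of x] assms by (auto simp: E_inf_eq_formal well_bounded_def)

lemma vcomp_boundary:
  assumes "vdefined B y x"
  shows "vcomp y x \<in> E_inf B"
    "pdom (vcomp y x) = pdom x" "pcod B (vcomp y x) = pcod B y"
    "psrc B (vcomp y x) = Cmp (deco B) (psrc B y) (psrc B x)"
    "ptrg B (vcomp y x) = Cmp (deco B) (ptrg B y) (ptrg B x)"
  using assms well_bounded_vcomp[of x y] formal_well_bounded[of x] formal_well_bounded[of y]
  by (auto simp: vdefined_def E_inf_eq_formal formal_vcomp)

lemma hconc_boundary:
  assumes "hdefined B y x"
  shows "hconc B y x \<in> E_inf B"
    "psrc B (hconc B y x) = psrc B x" "ptrg B (hconc B y x) = ptrg B y"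
    "trg B (pdom x) = src B (pdom y)" "trg B (pcod B x) = src B (pcod B y)"
proof -
  have "x \<in> E_inf B" "y \<in> E_inf B" "ptrg B x = psrc B y"
    using assms by (auto simp: hdefined_def)
  then show "trg B (pdom x) = src B (pdom y)" "trg B (pcod B x) = src B (pcod B y)"
    using E_inf_boundary[of x] E_inf_boundary[of y] by metis+
qed (use assms well_bounded_hconc[of x y] formal_well_bounded[of x] formal_well_bounded[of y]
    in \<open>auto simp: hdefined_def E_inf_eq_formal formal_hconc\<close>)

lemma generator_boundary:
  shows "\<alpha> \<in> Obj (cells B) \<Longrightarrow> empty_path \<alpha> \<in> E_inf B"
    "\<phi> \<in> Mor (cells B) \<Longrightarrow> cell B \<phi> \<in> E_inf B"
    "f \<in> Mor (deco B) \<Longrightarrow> hsym B f \<in> E_inf B"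
    "psrc B (empty_path \<alpha>) = Ide (deco B) (src B \<alpha>)"
    "ptrg B (empty_path \<alpha>) = Ide (deco B) (trg B \<alpha>)"
  by (auto simp: E_inf_eq_formal formal_empty formal_cell formal_hsym) (auto simp: empty_path_def)

section \<open>Definedness of the composites in the relations\<close>

lemma cell_hdefined:
  assumes "\<phi> \<in> Mor (cells B)" "\<psi> \<in> Mor (cells B)"
    and "trg B (Dom (cells B) \<phi>) = src B (Dom (cells B) \<psi>)"
  shows "hdefined B (cell B \<psi>) (cell B \<phi>)"
  using assms by (simp add: hdefined_def generator_boundary psrc_cell)

lemma cell_boundary_eq:
  assumes "\<phi> \<in> Mor (cells B)"
  shows "src B (Cod (cells B) \<phi>) = src B (Dom (cells B) \<phi>)"
    "trg B (Cod (cells B) \<phi>) = trg B (Dom (cells B) \<phi>)"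
  using parallel[OF assms] by auto

lemma left_unit_vdefined:
  assumes "x \<in> E_inf B"
  shows "hdefined B (hsym B (ptrg B x)) x"
    "vdefined B (cell B (lun B (pcod B x))) (hconc B (hsym B (ptrg B x)) x)"
    "vdefined B (hconc B (hsym B (ptrg B x)) x) (cell B (inv_mor (cells B) (lun B (pdom x))))"
proof -
  note [simp] = E_inf_boundary[OF assms] generator_boundary psrc_hsym
  show h: "hdefined B (hsym B (ptrg B x)) x"
    using assms by (simp add: hdefined_def)
  show "vdefined B (cell B (lun B (pcod B x))) (hconc B (hsym B (ptrg B x)) x)"
    using h by (simp add: vdefined_def hconc_boundary(1) lun_iso)
  show "vdefined B (hconc B (hsym B (ptrg B x)) x) (cell B (inv_mor (cells B) (lun B (pdom x))))"
    using h lun_iso[of "pdom x"] by (simp add: vdefined_def hconc_boundary(1) inverse_of_def)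
qed

lemma right_unit_vdefined:
  assumes "x \<in> E_inf B"
  shows "hdefined B x (hsym B (psrc B x))"
    "vdefined B (cell B (run B (pcod B x))) (hconc B x (hsym B (psrc B x)))"
    "vdefined B (hconc B x (hsym B (psrc B x))) (cell B (inv_mor (cells B) (run B (pdom x))))"
proof -
  note [simp] = E_inf_boundary[OF assms] generator_boundary psrc_hsym
  show h: "hdefined B x (hsym B (psrc B x))"
    using assms by (simp add: hdefined_def)
  show "vdefined B (cell B (run B (pcod B x))) (hconc B x (hsym B (psrc B x)))"
    using h by (simp add: vdefined_def hconc_boundary(1) run_iso)
  show "vdefined B (hconc B x (hsym B (psrc B x))) (cell B (inv_mor (cells B) (run B (pdom x))))"
    using h run_iso[of "pdom x"] by (simp add: vdefined_def hconc_boundary(1) inverse_of_def)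
qed

lemma vcomp3_boundary:
  assumes "vdefined B z y" "vdefined B y x"
  shows "vdefined B z (vcomp y x)"
    "psrc B (vcomp z (vcomp y x)) = Cmp (deco B) (psrc B z) (Cmp (deco B) (psrc B y) (psrc B x))"
    "ptrg B (vcomp z (vcomp y x)) = Cmp (deco B) (ptrg B z) (Cmp (deco B) (ptrg B y) (ptrg B x))"
proof -
  show "vdefined B z (vcomp y x)"
    using assms vcomp_boundary[OF assms(2)] by (simp add: vdefined_def)
  then show "psrc B (vcomp z (vcomp y x)) = Cmp (deco B) (psrc B z) (Cmp (deco B) (psrc B y) (psrc B x))"
    "ptrg B (vcomp z (vcomp y x)) = Cmp (deco B) (ptrg B z) (Cmp (deco B) (ptrg B y) (ptrg B x))"
    using vcomp_boundary[OF assms(2)] by (simp_all add: vcomp_boundary)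
qed

lemma assoc_hdefined:
  assumes "hdefined B y x" "hdefined B z y"
  shows "hdefined B z (hconc B y x)" "hdefined B (hconc B z y) x"
    "vdefined B (cell B (asc B (pcod B z) (pcod B y) (pcod B x))) (hconc B z (hconc B y x))"
    "vdefined B (hconc B (hconc B z y) x) (cell B (asc B (pdom z) (pdom y) (pdom x)))"
proof -
  have e: "x \<in> E_inf B" "y \<in> E_inf B" "z \<in> E_inf B" "ptrg B x = psrc B y" "ptrg B y = psrc B z"
    using assms by (auto simp: hdefined_def)
  note [simp] = this E_inf_boundary(1,2)[OF e(1)] E_inf_boundary(1,2)[OF e(2)] E_inf_boundary(1,2)[OF e(3)]
    hconc_boundary[OF assms(1)] hconc_boundary[OF assms(2)] generator_boundary
  show h: "hdefined B z (hconc B y x)" "hdefined B (hconc B z y) x"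
    by (auto simp: hdefined_def)
  show "vdefined B (cell B (asc B (pcod B z) (pcod B y) (pcod B x))) (hconc B z (hconc B y x))"
    "vdefined B (hconc B (hconc B z y) x) (cell B (asc B (pdom z) (pdom y) (pdom x)))"
    using h by (auto simp: vdefined_def hconc_boundary(1) asc_iso)
qed

lemma exchange_defined:
  assumes "hdefined B y2 y1" "hdefined B x2 x1" "vdefined B y2 x2" "vdefined B y1 x1"
  shows "vdefined B (hconc B y2 y1) (hconc B x2 x1)" "hdefined B (vcomp y2 x2) (vcomp y1 x1)"
proof -
  show "vdefined B (hconc B y2 y1) (hconc B x2 x1)"
    using assms(3,4) hconc_boundary(1)[OF assms(1)] hconc_boundary(1)[OF assms(2)] by (simp add: vdefined_def)
  show "hdefined B (vcomp y2 x2) (vcomp y1 x1)"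
    using assms(1,2) vcomp_boundary[OF assms(3)] vcomp_boundary[OF assms(4)] by (simp add: hdefined_def)
qed

section \<open>The quotient\<close>

text \<open>The invariant of the congruence. Membership of both paths is included because it places
  \<open>R_inf B\<close> inside the square of its carrier and is needed for definedness after a
  change of representatives.\<close>

definition parallel_paths :: "('h, 'c, 'f) path \<Rightarrow> ('h, 'c, 'f) path \<Rightarrow> bool" where
  "parallel_paths x y \<longleftrightarrow> x \<in> E_inf B \<and> y \<in> E_inf B \<and> pdom x = pdom y \<and> pcod B x = pcod B y \<and>
     psrc B x = psrc B y \<and> ptrg B x = ptrg B y"

text \<open>For horizontal composites \<open>psrc\<close> reads the right factor and
  \<open>ptrg\<close> the left one, which settles the exchange relation. Structure cells have
  identities of the decoration as source and target, and these are absorbed by the unit laws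
  there.\<close>

lemma R_inf_parallel: "(x, y) \<in> R_inf B \<Longrightarrow> parallel_paths x y"
proof (induction rule: R_inf.induct)
  case (vcomp_cong x x' y y')
  then show ?case by (auto simp: parallel_paths_def vcomp_boundary)
next
  case (hconc_cong x x' y y')
  then show ?case by (auto simp: parallel_paths_def hconc_boundary(1-3))
next
  case (exchange y2 y1 x2 x1)
  note d = exchange_defined[OF exchange]
  have "pcod B x2 = pdom y2" "pcod B x1 = pdom y1"
    using exchange by (auto simp: vdefined_def)
  then show ?case
    using exchange d
    by (simp add: parallel_paths_def vcomp_boundary hconc_boundary(1-3))
next
  case (vcomp_cell \<phi> \<psi>)
  then have "vdefined B (cell B \<psi>) (cell B \<phi>)"
    by (simp add: vdefined_def generator_boundary)
  then show ?case
    using vcomp_cell K.Cmp[of \<phi> \<psi>] K.Dom_Cod[of \<phi>] src_trg[of "Dom (cells B) \<phi>"]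
    by (auto simp: parallel_paths_def vcomp_boundary generator_boundary psrc_cell cell_boundary_eq Ide_deco)
next
  case (vcomp_hsym f g)
  then have "vdefined B (hsym B g) (hsym B f)"
    by (simp add: vdefined_def generator_boundary)
  then show ?case
    using vcomp_hsym D.Cmp[of f g]
    by (auto simp: parallel_paths_def vcomp_boundary generator_boundary psrc_hsym)
next
  case (ide_cell \<alpha>)
  then show ?case
    using K.Ide[of \<alpha>] by (auto simp: parallel_paths_def generator_boundary psrc_cell)
next
  case (ide_hsym a)
  then show ?case
    using K.Ide[of "hid B a"] hid_Obj[of a] D.Ide[of a]
    by (auto simp: parallel_paths_def generator_boundary psrc_cell psrc_hsym deco_Obj)
next
  case (hconc_cell \<phi> \<psi>)
  then show ?case
    using hconc_boundary(1-3)[OF cell_hdefined[OF hconc_cell]] K.Dom_Cod[of \<phi>] K.Dom_Cod[of \<psi>]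
    by (auto simp: parallel_paths_def hcomp2_Mor generator_boundary psrc_cell hcomp1_Obj)
next
  case (left_unit x)
  note d = left_unit_vdefined[OF left_unit] and b = E_inf_boundary[OF left_unit]
  note l = lun_iso[OF b(1)] lun_iso[OF b(2)]
  have i: "inv_mor (cells B) (lun B (pdom x)) \<in> Mor (cells B)"
    "Dom (cells B) (inv_mor (cells B) (lun B (pdom x))) = pdom x"
    using l by (auto simp: inverse_of_def)
  \<comment> \<open>\<open>psrc_cell\<close> refers to the domain of the unitor, which is a
    horizontal composite. The two boundary 1-cells of a cell are parallel, so the codomain
    \<open>pcod B x\<close> can be used instead.\<close>
  have s: "src B (Dom (cells B) (lun B (pcod B x))) = src B (pcod B x)"
    "trg B (Dom (cells B) (lun B (pcod B x))) = trg B (pcod B x)"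
    using cell_boundary_eq[OF l(5)] l by auto
  show ?case
    using left_unit d i l b vcomp3_boundary(1)[OF d(2,3)] s hconc_boundary(1-3)[OF d(1)]
    by (simp add: parallel_paths_def vcomp3_boundary(2,3) vcomp_boundary(1,3) psrc_cell
        psrc_hsym Cmp_Ide_deco)
next
  case (right_unit x)
  note d = right_unit_vdefined[OF right_unit] and b = E_inf_boundary[OF right_unit]
  note l = run_iso[OF b(1)] run_iso[OF b(2)]
  have i: "inv_mor (cells B) (run B (pdom x)) \<in> Mor (cells B)"
    "Dom (cells B) (inv_mor (cells B) (run B (pdom x))) = pdom x"
    using l by (auto simp: inverse_of_def)
  have s: "src B (Dom (cells B) (run B (pcod B x))) = src B (pcod B x)"
    "trg B (Dom (cells B) (run B (pcod B x))) = trg B (pcod B x)"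
    using cell_boundary_eq[OF l(5)] l by auto
  show ?case
    using right_unit d i l b vcomp3_boundary(1)[OF d(2,3)] s hconc_boundary(1-3)[OF d(1)]
    by (simp add: parallel_paths_def vcomp3_boundary(2,3) vcomp_boundary(1,3) psrc_cell
        psrc_hsym Cmp_Ide_deco)
next
  case (assoc y x z)
  note d = assoc_hdefined[OF assoc]
  have e: "x \<in> E_inf B" "y \<in> E_inf B" "z \<in> E_inf B"
    using assoc by (auto simp: hdefined_def)
  note b = E_inf_boundary[OF e(1)] E_inf_boundary[OF e(2)] E_inf_boundary[OF e(3)]
  note h = hconc_boundary[OF assoc(1)] hconc_boundary[OF assoc(2)] hconc_boundary[OF d(1)] hconc_boundary[OF d(2)]
  show ?case
    using vcomp_boundary[OF d(3)] vcomp_boundary[OF d(4)] h b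
    by (simp add: parallel_paths_def psrc_cell asc_iso hcomp1_Obj Cmp_Ide_deco)
qed (auto simp: parallel_paths_def)

lemma equiv_R_inf: "equiv (E_inf B) (R_inf B)"
proof (rule equivI)
  show "R_inf B \<subseteq> E_inf B \<times> E_inf B"
    using R_inf_parallel by (auto simp: parallel_paths_def)
  show "refl_on (E_inf B) (R_inf B)"
    by (auto intro!: refl_onI R_inf.refl)
  show "sym (R_inf B)"
    by (rule symI) (rule R_inf.sym)
  show "trans (R_inf B)"
    by (rule transI) (rule R_inf.trans)
qed

abbreviation cl :: "('h, 'c, 'f) path \<Rightarrow> ('h, 'c, 'f) path set" where
  "cl x \<equiv> R_inf B `` {x}"

lemma cl_eqI: "(x, y) \<in> R_inf B \<Longrightarrow> cl x = cl y"
  by (rule equiv_class_eq[OF equiv_R_inf])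

text \<open>All members of a class are parallel to \<open>x\<close>, so a map depending only on
  boundaries has a singleton image.\<close>

lemma the_elem_image_cl:
  assumes "x \<in> E_inf B" "\<And>y. parallel_paths x y \<Longrightarrow> f y = f x"
  shows "the_elem (f ` cl x) = f x"
  using assms R_inf_parallel by (intro the_elem_image_unique) (auto intro: R_inf.refl)

lemma V_inf_simps:
  "Obj (V_inf B) = Obj (cells B)"
  "Mor (V_inf B) = cl ` E_inf B"
  "Ide (V_inf B) \<alpha> = cl (empty_path \<alpha>)"
  "x \<in> E_inf B \<Longrightarrow> Dom (V_inf B) (cl x) = pdom x"
  "x \<in> E_inf B \<Longrightarrow> Cod (V_inf B) (cl x) = pcod B x"
  by (auto simp: V_inf_def quotient_cat_def F_inf_def quotient_def parallel_paths_def
      intro!: the_elem_image_cl)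

text \<open>Other representatives have the same boundaries, hence compose as well, and the
  congruence rule puts their composite in the same class. The set of candidate values is therefore a
  singleton. \<open>hsq_Q\<close> rests on the same argument.\<close>

lemma Cmp_V_inf:
  assumes "vdefined B y x"
  shows "Cmp (V_inf B) (cl y) (cl x) = cl (vcomp y x)"
proof -
  have "cl (vcomp y' x') = cl (vcomp y x)" if "(x, x') \<in> R_inf B" "(y, y') \<in> R_inf B" for x' y'
  proof -
    have "vdefined B y' x'"
      using assms R_inf_parallel[OF that(1)] R_inf_parallel[OF that(2)]
      by (auto simp: vdefined_def parallel_paths_def)
    then show ?thesis
      using that assms by (metis cl_eqI R_inf.vcomp_cong)
  qed
  moreover have "(x, x) \<in> R_inf B" "(y, y) \<in> R_inf B"
    using assms by (auto simp: vdefined_def intro: R_inf.refl)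
  ultimately have "{cl (vcomp y' x') | x' y'. x' \<in> cl x \<and> y' \<in> cl y} = {cl (vcomp y x)}"
    by blast
  then show ?thesis
    by (simp add: V_inf_def quotient_cat_def F_inf_def)
qed

lemma Q_simps:
  "C0 (Q B) = deco B" "C1 (Q B) = V_inf B"
  "on_obj (dsrc (Q B)) = src B" "on_obj (dtrg (Q B)) = trg B" "on_obj (dhid (Q B)) = hid B"
  "on_mor (dhid (Q B)) f = cl (hsym B f)"
  "hobj (Q B) \<beta> \<alpha> = hcomp1 B \<beta> \<alpha>"
  "dlun (Q B) \<alpha> = cl (cell B (lun B \<alpha>))"
  "drun (Q B) \<alpha> = cl (cell B (run B \<alpha>))"
  "dasc (Q B) \<gamma> \<beta> \<alpha> = cl (cell B (asc B \<gamma> \<beta> \<alpha>))"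
  "x \<in> E_inf B \<Longrightarrow> on_mor (dsrc (Q B)) (cl x) = psrc B x"
  "x \<in> E_inf B \<Longrightarrow> on_mor (dtrg (Q B)) (cl x) = ptrg B x"
  by (auto simp: Q_def parallel_paths_def intro!: the_elem_image_cl)

lemma hsq_Q:
  assumes "hdefined B y x"
  shows "hsq (Q B) (cl y) (cl x) = cl (hconc B y x)"
proof -
  have "cl (hconc B y' x') = cl (hconc B y x)" if "(x, x') \<in> R_inf B" "(y, y') \<in> R_inf B" for x' y'
  proof -
    have "hdefined B y' x'"
      using assms R_inf_parallel[OF that(1)] R_inf_parallel[OF that(2)]
      by (auto simp: hdefined_def parallel_paths_def)
    then show ?thesis
      using that assms by (metis cl_eqI R_inf.hconc_cong)
  qed
  moreover have "(x, x) \<in> R_inf B" "(y, y) \<in> R_inf B"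
    using assms by (auto simp: hdefined_def intro: R_inf.refl)
  ultimately have "{cl (hconc B y' x') | x' y'. x' \<in> cl x \<and> y' \<in> cl y} = {cl (hconc B y x)}"
    by blast
  then show ?thesis
    by (simp add: Q_def)
qed

lemma category_V_inf: "category (V_inf B)"
proof
  fix p assume "p \<in> Mor (V_inf B)"
  then obtain x where x: "x \<in> E_inf B" "p = cl x" by (auto simp: V_inf_simps)
  note b = E_inf_boundary[OF x(1)]
  show "Dom (V_inf B) p \<in> Obj (V_inf B) \<and> Cod (V_inf B) p \<in> Obj (V_inf B)"
    using x b by (simp add: V_inf_simps)
  have "vdefined B x (empty_path (pdom x))" "vdefined B (empty_path (pcod B x)) x"
    using x b by (auto simp: vdefined_def generator_boundary)
  then show "Cmp (V_inf B) p (Ide (V_inf B) (Dom (V_inf B) p)) = p \<and>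
      Cmp (V_inf B) (Ide (V_inf B) (Cod (V_inf B) p)) p = p"
    using x by (simp add: V_inf_simps Cmp_V_inf)
next
  fix \<alpha> assume "\<alpha> \<in> Obj (V_inf B)"
  then show "Ide (V_inf B) \<alpha> \<in> Mor (V_inf B) \<and> Dom (V_inf B) (Ide (V_inf B) \<alpha>) = \<alpha> \<and>
      Cod (V_inf B) (Ide (V_inf B) \<alpha>) = \<alpha>"
    by (simp add: V_inf_simps generator_boundary)
next
  fix p q
  assume "p \<in> Mor (V_inf B)" "q \<in> Mor (V_inf B)" "Dom (V_inf B) q = Cod (V_inf B) p"
  then obtain x y where "p = cl x" "q = cl y" and d: "vdefined B y x"
    by (auto simp: V_inf_simps vdefined_def)
  then show "Cmp (V_inf B) q p \<in> Mor (V_inf B) \<and> Dom (V_inf B) (Cmp (V_inf B) q p) = Dom (V_inf B) p \<and>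
      Cod (V_inf B) (Cmp (V_inf B) q p) = Cod (V_inf B) q"
    using vcomp_boundary[OF d] by (simp add: V_inf_simps Cmp_V_inf) (simp add: V_inf_simps vdefined_def)
next
  fix p q r
  assume "p \<in> Mor (V_inf B)" "q \<in> Mor (V_inf B)" "r \<in> Mor (V_inf B)"
    "Dom (V_inf B) q = Cod (V_inf B) p" "Dom (V_inf B) r = Cod (V_inf B) q"
  then obtain x y z where e: "p = cl x" "q = cl y" "r = cl z"
    and d: "vdefined B y x" "vdefined B z y"
    by (auto simp: V_inf_simps vdefined_def)
  then have "vdefined B z (vcomp y x)" "vdefined B (vcomp z y) x"
    using vcomp_boundary[OF d(1)] vcomp_boundary[OF d(2)] by (auto simp: vdefined_def)
  then show "Cmp (V_inf B) r (Cmp (V_inf B) q p) = Cmp (V_inf B) (Cmp (V_inf B) r q) p"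
    using e d by (simp add: Cmp_V_inf vcomp_assoc)
qed

interpretation V: category "V_inf B" by (rule category_V_inf)

section \<open>The cells of the bicategory inside the quotient\<close>

lemma Cmp_cl_cell:
  assumes "\<phi> \<in> Mor (cells B)" "\<psi> \<in> Mor (cells B)" "Dom (cells B) \<psi> = Cod (cells B) \<phi>"
  shows "Cmp (V_inf B) (cl (cell B \<psi>)) (cl (cell B \<phi>)) = cl (cell B (Cmp (cells B) \<psi> \<phi>))"
  using assms cl_eqI[OF R_inf.vcomp_cell[OF assms]]
  by (simp add: Cmp_V_inf vdefined_def generator_boundary)

lemma hsq_cl_cell:
  assumes "\<phi> \<in> Mor (cells B)" "\<psi> \<in> Mor (cells B)"
    and "trg B (Dom (cells B) \<phi>) = src B (Dom (cells B) \<psi>)"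
  shows "hsq (Q B) (cl (cell B \<psi>)) (cl (cell B \<phi>)) = cl (cell B (hcomp2 B \<psi> \<phi>))"
  using cl_eqI[OF R_inf.hconc_cell[OF assms]] by (simp add: hsq_Q cell_hdefined[OF assms])

text \<open>Identities of the quotient are classes of empty paths. Rewriting them as cells lets
  \<open>Cmp_cl_cell\<close> and \<open>hsq_cl_cell\<close> compute with them.\<close>

lemma Ide_V_inf_cell:
  "\<alpha> \<in> Obj (cells B) \<Longrightarrow> Ide (V_inf B) \<alpha> = cl (cell B (Ide (cells B) \<alpha>))"
  by (simp add: V_inf_simps cl_eqI R_inf.ide_cell)

lemma inverse_of_cl_cell:
  assumes "inverse_of (cells B) \<phi> \<psi>"
  shows "inverse_of (V_inf B) (cl (cell B \<phi>)) (cl (cell B \<psi>))"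
  using assms unfolding inverse_of_def
  by (simp add: Cmp_cl_cell Ide_V_inf_cell K.Dom_Cod V_inf_simps(2,4,5) generator_boundary)

section \<open>The double category\<close>

lemma functor_dsrc: "is_functor (V_inf B) (deco B) (dsrc (Q B))"
proof
  fix p q
  assume "p \<in> Mor (V_inf B)" "q \<in> Mor (V_inf B)" "Dom (V_inf B) q = Cod (V_inf B) p"
  then obtain x y where e: "p = cl x" "q = cl y" and d: "vdefined B y x"
    by (auto simp: V_inf_simps vdefined_def)
  then show "on_mor (dsrc (Q B)) (Cmp (V_inf B) q p) =
      Cmp (deco B) (on_mor (dsrc (Q B)) q) (on_mor (dsrc (Q B)) p)"
    using vcomp_boundary[OF d] by (simp add: Cmp_V_inf Q_simps) (simp add: vdefined_def Q_simps)
qed (auto simp: V_inf_simps Q_simps E_inf_boundary src_trg generator_boundary deco_Obj)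

lemma functor_dtrg: "is_functor (V_inf B) (deco B) (dtrg (Q B))"
proof
  fix p q
  assume "p \<in> Mor (V_inf B)" "q \<in> Mor (V_inf B)" "Dom (V_inf B) q = Cod (V_inf B) p"
  then obtain x y where e: "p = cl x" "q = cl y" and d: "vdefined B y x"
    by (auto simp: V_inf_simps vdefined_def)
  then show "on_mor (dtrg (Q B)) (Cmp (V_inf B) q p) =
      Cmp (deco B) (on_mor (dtrg (Q B)) q) (on_mor (dtrg (Q B)) p)"
    using vcomp_boundary[OF d] by (simp add: Cmp_V_inf Q_simps) (simp add: vdefined_def Q_simps)
qed (auto simp: V_inf_simps Q_simps E_inf_boundary src_trg generator_boundary deco_Obj)

lemma functor_dhid: "is_functor (deco B) (V_inf B) (dhid (Q B))"
proof
  fix a assume "a \<in> Obj (deco B)"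
  then show "on_mor (dhid (Q B)) (Ide (deco B) a) = Ide (V_inf B) (on_obj (dhid (Q B)) a)"
    using hid_Obj[of a] by (simp add: Q_simps Ide_V_inf_cell deco_Obj cl_eqI R_inf.ide_hsym)
next
  fix f g assume fg: "f \<in> Mor (deco B)" "g \<in> Mor (deco B)" "Dom (deco B) g = Cod (deco B) f"
  then have "vdefined B (hsym B g) (hsym B f)"
    by (simp add: vdefined_def generator_boundary)
  then show "on_mor (dhid (Q B)) (Cmp (deco B) g f) =
      Cmp (V_inf B) (on_mor (dhid (Q B)) g) (on_mor (dhid (Q B)) f)"
    using cl_eqI[OF R_inf.vcomp_hsym[OF fg]] by (simp add: Q_simps Cmp_V_inf)
qed (auto simp: V_inf_simps Q_simps generator_boundary deco_Obj hid_Obj)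

section \<open>Horizontal composition on composable pairs\<close>

lemma composable2_Obj:
  "(\<alpha>, \<beta>) \<in> Obj (composable2 (Q B)) \<longleftrightarrow> \<alpha> \<in> Obj (cells B) \<and> \<beta> \<in> Obj (cells B) \<and> trg B \<alpha> = src B \<beta>"
  by (simp add: composable2_def Q_simps V_inf_simps)

lemma composable2_simps:
  "Dom (composable2 (Q B)) (p, q) = (Dom (V_inf B) p, Dom (V_inf B) q)"
  "Cod (composable2 (Q B)) (p, q) = (Cod (V_inf B) p, Cod (V_inf B) q)"
  "Ide (composable2 (Q B)) (\<alpha>, \<beta>) = (Ide (V_inf B) \<alpha>, Ide (V_inf B) \<beta>)"
  "Cmp (composable2 (Q B)) (q, q') (p, p') = (Cmp (V_inf B) q p, Cmp (V_inf B) q' p')"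
  by (simp_all add: composable2_def Q_simps)

text \<open>Source and target are constant on classes, so two classes match exactly when arbitrarily
  chosen representatives do.\<close>

lemma composable2_Mor:
  "Mor (composable2 (Q B)) = {(cl x, cl y) | x y. hdefined B y x}"
proof (intro equalityI subsetI)
  fix p assume "p \<in> Mor (composable2 (Q B))"
  then obtain x y where "p = (cl x, cl y)" "x \<in> E_inf B" "y \<in> E_inf B" "ptrg B x = psrc B y"
    by (auto simp: composable2_def Q_simps V_inf_simps)
  then show "p \<in> {(cl x, cl y) | x y. hdefined B y x}"
    unfolding hdefined_def by blast
qed (auto simp: composable2_def hdefined_def Q_simps V_inf_simps)

lemma category_composable2: "category (composable2 (Q B))"
  unfolding composable2_def Q_simps by (rule category_pullback[OF functor_dtrg functor_dsrc])

lemma vdefined_of_classes: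
  assumes "x \<in> E_inf B" "y \<in> E_inf B" "Dom (V_inf B) (cl y) = Cod (V_inf B) (cl x)"
  shows "vdefined B y x"
  using assms by (simp add: vdefined_def V_inf_simps)

lemma functor_dhcomp: "is_functor (composable2 (Q B)) (V_inf B) (dhcomp (Q B))"
proof -
  interpret C2: category "composable2 (Q B)" by (rule category_composable2)
  show ?thesis
  proof
    fix a assume "a \<in> Obj (composable2 (Q B))"
    then obtain \<alpha> \<beta> where a: "a = (\<alpha>, \<beta>)" "\<alpha> \<in> Obj (cells B)" "\<beta> \<in> Obj (cells B)" "trg B \<alpha> = src B \<beta>"
      by (cases a) (auto simp: composable2_Obj)
    show "on_obj (dhcomp (Q B)) a \<in> Obj (V_inf B)"
      using a by (simp add: Q_simps V_inf_simps(1) hcomp1_Obj)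
    \<comment> \<open>The exchange relation speaks of composites only. Here the identities are
      rewritten as cells, and the claim becomes \<open>hcomp2_Ide\<close> in the bicategory.\<close>
    show "on_mor (dhcomp (Q B)) (Ide (composable2 (Q B)) a) = Ide (V_inf B) (on_obj (dhcomp (Q B)) a)"
      using a by (simp add: Q_simps composable2_simps Ide_V_inf_cell hcomp1_Obj hsq_cl_cell K.Ide hcomp2_Ide)
  next
    fix p assume "p \<in> Mor (composable2 (Q B))"
    then obtain x y where p: "p = (cl x, cl y)" and d: "hdefined B y x"
      by (auto simp: composable2_Mor)
    have "x \<in> E_inf B" "y \<in> E_inf B"
      using d by (auto simp: hdefined_def)
    then show "on_mor (dhcomp (Q B)) p \<in> Mor (V_inf B) \<and>
        Dom (V_inf B) (on_mor (dhcomp (Q B)) p) = on_obj (dhcomp (Q B)) (Dom (composable2 (Q B)) p) \<and>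
        Cod (V_inf B) (on_mor (dhcomp (Q B)) p) = on_obj (dhcomp (Q B)) (Cod (composable2 (Q B)) p)"
      using p d hconc_boundary(1)[OF d]
      by (simp add: hsq_Q composable2_simps) (simp add: Q_simps V_inf_simps)
  next
    fix p q
    assume "p \<in> Mor (composable2 (Q B))" "q \<in> Mor (composable2 (Q B))"
      and t: "Dom (composable2 (Q B)) q = Cod (composable2 (Q B)) p"
    then obtain x1 x2 y1 y2 where p: "p = (cl x1, cl x2)" "q = (cl y1, cl y2)"
      and d: "hdefined B x2 x1" "hdefined B y2 y1"
      by (auto simp: composable2_Mor)
    then have v: "vdefined B y1 x1" "vdefined B y2 x2"
      using t by (auto simp: composable2_simps hdefined_def intro!: vdefined_of_classes)
    show "on_mor (dhcomp (Q B)) (Cmp (composable2 (Q B)) q p) =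
        Cmp (V_inf B) (on_mor (dhcomp (Q B)) q) (on_mor (dhcomp (Q B)) p)"
      using p d v exchange_defined[OF d(2,1) v(2,1)] cl_eqI[OF R_inf.exchange[OF d(2,1) v(2,1)]]
      by (simp add: composable2_simps hsq_Q Cmp_V_inf)
  qed
qed

section \<open>Composable triples\<close>

lemma composable3_Obj:
  "(\<alpha>, \<beta>, \<gamma>) \<in> Obj (composable3 (Q B)) \<longleftrightarrow> \<alpha> \<in> Obj (cells B) \<and> \<beta> \<in> Obj (cells B) \<and>
    \<gamma> \<in> Obj (cells B) \<and> trg B \<alpha> = src B \<beta> \<and> trg B \<beta> = src B \<gamma>"
  by (auto simp: composable3_def composable2_Obj Q_simps V_inf_simps)

lemma composable3_simps:
  "Dom (composable3 (Q B)) (p, q, r) = (Dom (V_inf B) p, Dom (V_inf B) q, Dom (V_inf B) r)"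
  "Cod (composable3 (Q B)) (p, q, r) = (Cod (V_inf B) p, Cod (V_inf B) q, Cod (V_inf B) r)"
  "Ide (composable3 (Q B)) (\<alpha>, \<beta>, \<gamma>) = (Ide (V_inf B) \<alpha>, Ide (V_inf B) \<beta>, Ide (V_inf B) \<gamma>)"
  "Cmp (composable3 (Q B)) (q, q', q'') (p, p', p'') =
    (Cmp (V_inf B) q p, Cmp (V_inf B) q' p', Cmp (V_inf B) q'' p'')"
  by (simp_all add: composable3_def composable2_simps Q_simps)

lemma composable3_Mor:
  "Mor (composable3 (Q B)) = {(cl x, cl y, cl z) | x y z. hdefined B y x \<and> hdefined B z y}"
proof (intro equalityI subsetI)
  fix p assume "p \<in> Mor (composable3 (Q B))"
  then obtain x y z where "p = (cl x, cl y, cl z)" "x \<in> E_inf B" "y \<in> E_inf B" "z \<in> E_inf B"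
    "ptrg B x = psrc B y" "ptrg B y = psrc B z"
    by (auto simp: composable3_def composable2_def Q_simps V_inf_simps)
  then show "p \<in> {(cl x, cl y, cl z) | x y z. hdefined B y x \<and> hdefined B z y}"
    unfolding hdefined_def by blast
qed (auto simp: composable3_def composable2_def hdefined_def Q_simps V_inf_simps)

text \<open>The source of the first member is itself a functor on composable pairs, so triples again
  form a pullback of functors.\<close>

lemma category_composable3: "category (composable3 (Q B))"
proof -
  interpret C2: category "composable2 (Q B)" by (rule category_composable2)
  interpret S: is_functor "V_inf B" "deco B" "dsrc (Q B)" by (rule functor_dsrc)
  have "is_functor (composable2 (Q B)) (deco B)
      \<lparr>on_obj = (\<lambda>(\<beta>, \<gamma>). on_obj (dsrc (Q B)) \<beta>), on_mor = (\<lambda>(\<Psi>, \<Theta>). on_mor (dsrc (Q B)) \<Psi>)\<rparr>"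
    by unfold_locales
      (auto simp: composable2_def Q_simps(1,2) S.on_obj S.on_mor S.on_Ide S.on_Cmp)
  then show ?thesis
    unfolding composable3_def Q_simps(1,2) by (rule category_pullback[OF functor_dtrg])
qed

lemma functor_hsq:
  assumes "is_functor X (V_inf B) F" "is_functor X (V_inf B) G"
    and "\<And>a. a \<in> Obj X \<Longrightarrow> trg B (on_obj F a) = src B (on_obj G a)"
    and "\<And>f. f \<in> Mor X \<Longrightarrow> on_mor (dtrg (Q B)) (on_mor F f) = on_mor (dsrc (Q B)) (on_mor G f)"
  shows "is_functor X (V_inf B) \<lparr>on_obj = (\<lambda>a. hobj (Q B) (on_obj G a) (on_obj F a)),
    on_mor = (\<lambda>f. hsq (Q B) (on_mor G f) (on_mor F f))\<rparr>"
  using assms functor_dhcomp[unfolded composable2_def Q_simps(2)]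
  by (intro is_functor_pairing[where S = "dtrg (Q B)" and T = "dsrc (Q B)"]) (auto simp: Q_simps)

section \<open>Unitors\<close>

lemma hsq_hsym:
  assumes "x \<in> E_inf B"
  shows "hsq (Q B) (on_mor (dhid (Q B)) (on_mor (dtrg (Q B)) (cl x))) (cl x) = cl (hconc B (hsym B (ptrg B x)) x)"
    "hsq (Q B) (cl x) (on_mor (dhid (Q B)) (on_mor (dsrc (Q B)) (cl x))) = cl (hconc B x (hsym B (psrc B x)))"
  using assms left_unit_vdefined(1)[OF assms] right_unit_vdefined(1)[OF assms]
  by (simp_all add: Q_simps hsq_Q)

lemma dlun_natural:
  assumes x: "x \<in> E_inf B"
  shows "Cmp (V_inf B) (cl (cell B (lun B (pcod B x)))) (cl (hconc B (hsym B (ptrg B x)) x)) =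
    Cmp (V_inf B) (cl x) (cl (cell B (lun B (pdom x))))"
proof -
  note d = left_unit_vdefined[OF x] and b = E_inf_boundary[OF x]
  note i = inverse_of_cl_cell[OF lun_iso(4)[OF b(1)]]
  have "cl x = Cmp (V_inf B) (cl (cell B (lun B (pcod B x))))
      (Cmp (V_inf B) (cl (hconc B (hsym B (ptrg B x)) x)) (cl (cell B (inv_mor (cells B) (lun B (pdom x))))))"
    using cl_eqI[OF R_inf.left_unit[OF x]] d vcomp3_boundary(1)[OF d(2,3)] by (simp add: Cmp_V_inf)
  then show ?thesis
    using d b V.conjugate_square[OF i, of "cl (hconc B (hsym B (ptrg B x)) x)" "cl (cell B (lun B (pcod B x)))"]
    by (simp add: V_inf_simps(2,4,5) hconc_boundary(1) generator_boundary lun_iso psrc_hsym)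
qed

lemma drun_natural:
  assumes x: "x \<in> E_inf B"
  shows "Cmp (V_inf B) (cl (cell B (run B (pcod B x)))) (cl (hconc B x (hsym B (psrc B x)))) =
    Cmp (V_inf B) (cl x) (cl (cell B (run B (pdom x))))"
proof -
  note d = right_unit_vdefined[OF x] and b = E_inf_boundary[OF x]
  note i = inverse_of_cl_cell[OF run_iso(4)[OF b(1)]]
  have "cl x = Cmp (V_inf B) (cl (cell B (run B (pcod B x))))
      (Cmp (V_inf B) (cl (hconc B x (hsym B (psrc B x)))) (cl (cell B (inv_mor (cells B) (run B (pdom x))))))"
    using cl_eqI[OF R_inf.right_unit[OF x]] d vcomp3_boundary(1)[OF d(2,3)] by (simp add: Cmp_V_inf)
  then show ?thesis
    using d b V.conjugate_square[OF i, of "cl (hconc B x (hsym B (psrc B x)))" "cl (cell B (run B (pcod B x)))"]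
    by (simp add: V_inf_simps(2,4,5) hconc_boundary(1) generator_boundary run_iso psrc_hsym)
qed

lemma natural_isomorphism_dlun:
  "natural_isomorphism (V_inf B) (V_inf B)
     \<lparr>on_obj = (\<lambda>\<alpha>. hobj (Q B) (on_obj (dhid (Q B)) (on_obj (dtrg (Q B)) \<alpha>)) \<alpha>),
      on_mor = (\<lambda>\<Phi>. hsq (Q B) (on_mor (dhid (Q B)) (on_mor (dtrg (Q B)) \<Phi>)) \<Phi>)\<rparr>
     id_map (dlun (Q B))"
  (is "natural_isomorphism _ _ ?F _ _")
proof (rule natural_isomorphism.intro)
  note i = is_functor_id_map[OF category_V_inf]
  then show "is_functor (V_inf B) (V_inf B) id_map" .
  show "is_functor (V_inf B) (V_inf B) ?F"
    \<comment> \<open>The identity functor is paired with \<open>dhid\<close> after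
      \<open>dtrg\<close>. They match because the horizontal identity of a vertical morphism has
      that morphism as its source.\<close>
    using functor_hsq[OF i is_functor_compose[OF functor_dtrg functor_dhid]]
    by (force simp: id_map_def V_inf_simps(1,2) Q_simps generator_boundary E_inf_boundary psrc_hsym hid_Obj src_trg)
  show "natural_isomorphism_axioms (V_inf B) (V_inf B) ?F id_map (dlun (Q B))"
  proof
    fix \<alpha> assume "\<alpha> \<in> Obj (V_inf B)"
    then have a: "\<alpha> \<in> Obj (cells B)" by (simp add: V_inf_simps)
    show "\<exists>g. inverse_of (V_inf B) (dlun (Q B) \<alpha>) g"
      unfolding Q_simps using inverse_of_cl_cell[OF lun_iso(4)[OF a]] by blast
  next
    fix p assume "p \<in> Mor (V_inf B)"
    then obtain x where "x \<in> E_inf B" "p = cl x" by (auto simp: V_inf_simps)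
    then show "Cmp (V_inf B) (dlun (Q B) (Cod (V_inf B) p)) (on_mor ?F p) =
        Cmp (V_inf B) (on_mor id_map p) (dlun (Q B) (Dom (V_inf B) p))"
      by (simp add: hsq_hsym) (simp add: Q_simps V_inf_simps(4,5) dlun_natural id_map_def)
  qed (simp add: V_inf_simps Q_simps lun_iso generator_boundary id_map_def)
qed

lemma natural_isomorphism_drun:
  "natural_isomorphism (V_inf B) (V_inf B)
     \<lparr>on_obj = (\<lambda>\<alpha>. hobj (Q B) \<alpha> (on_obj (dhid (Q B)) (on_obj (dsrc (Q B)) \<alpha>))),
      on_mor = (\<lambda>\<Phi>. hsq (Q B) \<Phi> (on_mor (dhid (Q B)) (on_mor (dsrc (Q B)) \<Phi>)))\<rparr>
     id_map (drun (Q B))"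
  (is "natural_isomorphism _ _ ?F _ _")
proof (rule natural_isomorphism.intro)
  note i = is_functor_id_map[OF category_V_inf]
  then show "is_functor (V_inf B) (V_inf B) id_map" .
  show "is_functor (V_inf B) (V_inf B) ?F"
    using functor_hsq[OF is_functor_compose[OF functor_dsrc functor_dhid] i]
    by (force simp: id_map_def V_inf_simps(1,2) Q_simps generator_boundary E_inf_boundary psrc_hsym hid_Obj src_trg)
  show "natural_isomorphism_axioms (V_inf B) (V_inf B) ?F id_map (drun (Q B))"
  proof
    fix \<alpha> assume "\<alpha> \<in> Obj (V_inf B)"
    then have a: "\<alpha> \<in> Obj (cells B)" by (simp add: V_inf_simps)
    show "\<exists>g. inverse_of (V_inf B) (drun (Q B) \<alpha>) g"
      unfolding Q_simps using inverse_of_cl_cell[OF run_iso(4)[OF a]] by blast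
  next
    fix p assume "p \<in> Mor (V_inf B)"
    then obtain x where "x \<in> E_inf B" "p = cl x" by (auto simp: V_inf_simps)
    then show "Cmp (V_inf B) (drun (Q B) (Cod (V_inf B) p)) (on_mor ?F p) =
        Cmp (V_inf B) (on_mor id_map p) (drun (Q B) (Dom (V_inf B) p))"
      by (simp add: hsq_hsym) (simp add: Q_simps V_inf_simps(4,5) drun_natural id_map_def)
  qed (simp add: V_inf_simps Q_simps run_iso generator_boundary id_map_def)
qed

section \<open>Associator\<close>

lemma functor_projections:
  "is_functor (composable3 (Q B)) (V_inf B) \<lparr>on_obj = (\<lambda>(\<alpha>, \<beta>, \<gamma>). \<alpha>), on_mor = (\<lambda>(\<Phi>, \<Psi>, \<Theta>). \<Phi>)\<rparr>"
  "is_functor (composable3 (Q B)) (V_inf B) \<lparr>on_obj = (\<lambda>(\<alpha>, \<beta>, \<gamma>). \<beta>), on_mor = (\<lambda>(\<Phi>, \<Psi>, \<Theta>). \<Psi>)\<rparr>"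
  "is_functor (composable3 (Q B)) (V_inf B) \<lparr>on_obj = (\<lambda>(\<alpha>, \<beta>, \<gamma>). \<gamma>), on_mor = (\<lambda>(\<Phi>, \<Psi>, \<Theta>). \<Theta>)\<rparr>"
  by (intro is_functor.intro category_composable3 category_V_inf is_functor_axioms.intro;
      auto simp: composable3_def composable2_def Q_simps(2))+

text \<open>Each bracketing pairs one projection with a binary composite of the other two, which is
  itself a pairing of projections.\<close>

lemma functor_triple_composites:
  "is_functor (composable3 (Q B)) (V_inf B)
     \<lparr>on_obj = (\<lambda>(\<alpha>, \<beta>, \<gamma>). hobj (Q B) \<gamma> (hobj (Q B) \<beta> \<alpha>)),
      on_mor = (\<lambda>(\<Phi>, \<Psi>, \<Theta>). hsq (Q B) \<Theta> (hsq (Q B) \<Psi> \<Phi>))\<rparr>" (is ?r)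
  "is_functor (composable3 (Q B)) (V_inf B)
     \<lparr>on_obj = (\<lambda>(\<alpha>, \<beta>, \<gamma>). hobj (Q B) (hobj (Q B) \<gamma> \<beta>) \<alpha>),
      on_mor = (\<lambda>(\<Phi>, \<Psi>, \<Theta>). hsq (Q B) (hsq (Q B) \<Theta> \<Psi>) \<Phi>)\<rparr>" (is ?l)
proof -
  note P = functor_projections
  \<comment> \<open>The matching conditions on 1-cells: the first two for the inner pairings, the
    last two for the outer ones. \<open>m\<close> gives their counterparts for squares.\<close>
  have o: "\<And>\<alpha> \<beta> \<gamma>. (\<alpha>, \<beta>, \<gamma>) \<in> Obj (composable3 (Q B)) \<Longrightarrow> trg B \<alpha> = src B \<beta>"
    "\<And>\<alpha> \<beta> \<gamma>. (\<alpha>, \<beta>, \<gamma>) \<in> Obj (composable3 (Q B)) \<Longrightarrow> trg B \<beta> = src B \<gamma>"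
    "\<And>\<alpha> \<beta> \<gamma>. (\<alpha>, \<beta>, \<gamma>) \<in> Obj (composable3 (Q B)) \<Longrightarrow> trg B (hobj (Q B) \<beta> \<alpha>) = src B \<gamma>"
    "\<And>\<alpha> \<beta> \<gamma>. (\<alpha>, \<beta>, \<gamma>) \<in> Obj (composable3 (Q B)) \<Longrightarrow> trg B \<alpha> = src B (hobj (Q B) \<gamma> \<beta>)"
    by (simp_all add: composable3_Obj Q_simps hcomp1_Obj)
  have m: "on_mor (dtrg (Q B)) \<Phi> = on_mor (dsrc (Q B)) \<Psi>"
    "on_mor (dtrg (Q B)) \<Psi> = on_mor (dsrc (Q B)) \<Theta>"
    "on_mor (dtrg (Q B)) (hsq (Q B) \<Psi> \<Phi>) = on_mor (dsrc (Q B)) \<Theta>"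
    "on_mor (dtrg (Q B)) \<Phi> = on_mor (dsrc (Q B)) (hsq (Q B) \<Theta> \<Psi>)"
    if mor: "(\<Phi>, \<Psi>, \<Theta>) \<in> Mor (composable3 (Q B))" for \<Phi> \<Psi> \<Theta>
  proof -
    obtain x y z where e: "\<Phi> = cl x" "\<Psi> = cl y" "\<Theta> = cl z"
      and d: "hdefined B y x" "hdefined B z y"
      using mor by (auto simp: composable3_Mor)
    then have "x \<in> E_inf B" "y \<in> E_inf B" "z \<in> E_inf B" "ptrg B x = psrc B y" "ptrg B y = psrc B z"
      by (auto simp: hdefined_def)
    then show "on_mor (dtrg (Q B)) \<Phi> = on_mor (dsrc (Q B)) \<Psi>"
      "on_mor (dtrg (Q B)) \<Psi> = on_mor (dsrc (Q B)) \<Theta>"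
      "on_mor (dtrg (Q B)) (hsq (Q B) \<Psi> \<Phi>) = on_mor (dsrc (Q B)) \<Theta>"
      "on_mor (dtrg (Q B)) \<Phi> = on_mor (dsrc (Q B)) (hsq (Q B) \<Theta> \<Psi>)"
      using d hconc_boundary(1-3)[OF d(1)] hconc_boundary(1-3)[OF d(2)]
      unfolding e hsq_Q[OF d(1)] hsq_Q[OF d(2)] by (simp_all add: Q_simps)
  qed
  have "is_functor (composable3 (Q B)) (V_inf B)
     \<lparr>on_obj = (\<lambda>(\<alpha>, \<beta>, \<gamma>). hobj (Q B) \<beta> \<alpha>), on_mor = (\<lambda>(\<Phi>, \<Psi>, \<Theta>). hsq (Q B) \<Psi> \<Phi>)\<rparr>"
    using functor_hsq[OF P(1,2)] o(1) m(1) by (simp add: case_prod_beta' split_paired_all)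
  from functor_hsq[OF this P(3)] o(3) m(3) show ?r
    by (simp add: case_prod_beta' split_paired_all)
  have "is_functor (composable3 (Q B)) (V_inf B)
     \<lparr>on_obj = (\<lambda>(\<alpha>, \<beta>, \<gamma>). hobj (Q B) \<gamma> \<beta>), on_mor = (\<lambda>(\<Phi>, \<Psi>, \<Theta>). hsq (Q B) \<Theta> \<Psi>)\<rparr>"
    using functor_hsq[OF P(2,3)] o(2) m(2) by (simp add: case_prod_beta' split_paired_all)
  from functor_hsq[OF P(1) this] o(4) m(4) show ?l
    by (simp add: case_prod_beta' split_paired_all)
qed

lemma natural_isomorphism_dasc:
  "natural_isomorphism (composable3 (Q B)) (V_inf B)
     \<lparr>on_obj = (\<lambda>(\<alpha>, \<beta>, \<gamma>). hobj (Q B) \<gamma> (hobj (Q B) \<beta> \<alpha>)),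
      on_mor = (\<lambda>(\<Phi>, \<Psi>, \<Theta>). hsq (Q B) \<Theta> (hsq (Q B) \<Psi> \<Phi>))\<rparr>
     \<lparr>on_obj = (\<lambda>(\<alpha>, \<beta>, \<gamma>). hobj (Q B) (hobj (Q B) \<gamma> \<beta>) \<alpha>),
      on_mor = (\<lambda>(\<Phi>, \<Psi>, \<Theta>). hsq (Q B) (hsq (Q B) \<Theta> \<Psi>) \<Phi>)\<rparr>
     (\<lambda>(\<alpha>, \<beta>, \<gamma>). dasc (Q B) \<gamma> \<beta> \<alpha>)"
  (is "natural_isomorphism _ _ ?F ?G ?a")
proof (intro natural_isomorphism.intro functor_triple_composites natural_isomorphism_axioms.intro)
  fix a assume "a \<in> Obj (composable3 (Q B))"
  then obtain \<alpha> \<beta> \<gamma> where a: "a = (\<alpha>, \<beta>, \<gamma>)" and o: "\<alpha> \<in> Obj (cells B)" "\<beta> \<in> Obj (cells B)"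
    "\<gamma> \<in> Obj (cells B)" "trg B \<alpha> = src B \<beta>" "trg B \<beta> = src B \<gamma>"
    by (cases a) (auto simp: composable3_Obj)
  note i = asc_iso[OF o]
  show "?a a \<in> Mor (V_inf B) \<and>
      Dom (V_inf B) (?a a) = on_obj ?F a \<and> Cod (V_inf B) (?a a) = on_obj ?G a"
    using a i(1-3) by (simp add: Q_simps V_inf_simps(2,4,5) generator_boundary)
  show "\<exists>g. inverse_of (V_inf B) (?a a) g"
    using a i(4) by (auto simp: Q_simps intro: inverse_of_cl_cell)
next
  fix p assume "p \<in> Mor (composable3 (Q B))"
  then obtain x y z where p: "p = (cl x, cl y, cl z)" and d: "hdefined B y x" "hdefined B z y"
    by (auto simp: composable3_Mor)
  then have "x \<in> E_inf B" "y \<in> E_inf B" "z \<in> E_inf B"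
    by (auto simp: hdefined_def)
  then show "Cmp (V_inf B) (?a (Cod (composable3 (Q B)) p)) (on_mor ?F p) =
      Cmp (V_inf B) (on_mor ?G p) (?a (Dom (composable3 (Q B)) p))"
    using p d assoc_hdefined[OF d] cl_eqI[OF R_inf.assoc[OF d]]
    by (simp add: composable3_simps V_inf_simps(4,5) Q_simps(10) hsq_Q Cmp_V_inf)
qed

section \<open>Globularity, coherence and generation\<close>

lemma globular_cell:
  assumes "\<phi> \<in> Mor (cells B)"
  shows "globular (Q B) (cl (cell B \<phi>))"
  using assms K.Dom_Cod[OF assms] src_trg[of "Dom (cells B) \<phi>"]
  by (auto simp: globular_def Q_simps V_inf_simps generator_boundary psrc_cell deco_Obj)

lemma triangle_Q:
  assumes "(\<alpha>, \<beta>) \<in> Obj (composable2 (Q B))"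
  shows "Cmp (V_inf B) (hsq (Q B) (drun (Q B) \<beta>) (Ide (V_inf B) \<alpha>))
      (dasc (Q B) \<beta> (on_obj (dhid (Q B)) (on_obj (dtrg (Q B)) \<alpha>)) \<alpha>)
    = hsq (Q B) (Ide (V_inf B) \<beta>) (dlun (Q B) \<alpha>)"
proof -
  have o: "\<alpha> \<in> Obj (cells B)" "\<beta> \<in> Obj (cells B)" "trg B \<alpha> = src B \<beta>"
    using assms by (auto simp: composable2_Obj)
  \<comment> \<open>The middle object is stated as \<open>trg B \<alpha>\<close> but is rewritten by
    \<open>o\<close> to \<open>src B \<beta>\<close>, hence this instance.\<close>
  note h = hid_Obj[of "src B \<beta>"] src_trg[OF o(1)] src_trg[OF o(2)]
  show ?thesis
    using o h triangle[OF o]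
    by (simp add: Q_simps Ide_V_inf_cell K.Ide hsq_cl_cell Cmp_cl_cell hcomp2_Mor hcomp1_Obj
        lun_iso run_iso asc_iso)
qed

lemma pentagon_Q:
  assumes "(\<alpha>, \<beta>) \<in> Obj (composable2 (Q B))" "(\<beta>, \<gamma>) \<in> Obj (composable2 (Q B))"
    and "(\<gamma>, \<delta>) \<in> Obj (composable2 (Q B))"
  shows "Cmp (V_inf B) (dasc (Q B) (hobj (Q B) \<delta> \<gamma>) \<beta> \<alpha>) (dasc (Q B) \<delta> \<gamma> (hobj (Q B) \<beta> \<alpha>))
    = Cmp (V_inf B) (hsq (Q B) (dasc (Q B) \<delta> \<gamma> \<beta>) (Ide (V_inf B) \<alpha>))
        (Cmp (V_inf B) (dasc (Q B) \<delta> (hobj (Q B) \<gamma> \<beta>) \<alpha>)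
          (hsq (Q B) (Ide (V_inf B) \<delta>) (dasc (Q B) \<gamma> \<beta> \<alpha>)))"
proof -
  have o: "\<alpha> \<in> Obj (cells B)" "\<beta> \<in> Obj (cells B)" "\<gamma> \<in> Obj (cells B)" "\<delta> \<in> Obj (cells B)"
    "trg B \<alpha> = src B \<beta>" "trg B \<beta> = src B \<gamma>" "trg B \<gamma> = src B \<delta>"
    using assms by (auto simp: composable2_Obj)
  show ?thesis
    using o pentagon[OF o]
    by (simp add: Q_simps Ide_V_inf_cell K.Ide K.Cmp hsq_cl_cell Cmp_cl_cell hcomp2_Mor hcomp1_Obj asc_iso)
qed

lemma double_category_Q: "double_category (Q B)"
proof (rule double_category.intro, unfold Q_simps(1,2))
  show "category (deco B)" by (rule deco)
  fix f assume "f \<in> Mor (deco B)"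
  then show "on_mor (dsrc (Q B)) (on_mor (dhid (Q B)) f) = f \<and> on_mor (dtrg (Q B)) (on_mor (dhid (Q B)) f) = f"
    by (simp add: Q_simps generator_boundary psrc_hsym)
next
  fix \<Phi> \<Psi> assume "(\<Phi>, \<Psi>) \<in> Mor (composable2 (Q B))"
  then obtain x y where e: "\<Phi> = cl x" "\<Psi> = cl y" and d: "hdefined B y x"
    by (auto simp: composable2_Mor)
  then have "x \<in> E_inf B" "y \<in> E_inf B"
    by (auto simp: hdefined_def)
  then show "on_mor (dsrc (Q B)) (hsq (Q B) \<Psi> \<Phi>) = on_mor (dsrc (Q B)) \<Phi> \<and>
      on_mor (dtrg (Q B)) (hsq (Q B) \<Psi> \<Phi>) = on_mor (dtrg (Q B)) \<Psi>"
    using hconc_boundary(1-3)[OF d] unfolding e hsq_Q[OF d] by (simp add: Q_simps)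
\<comment> \<open>What remains is either one of the listed facts or, for the axioms on objects and
  on globularity, a statement about 1-cells and cells of the bicategory.\<close>
qed (fact category_V_inf functor_dsrc functor_dtrg functor_dhid functor_dhcomp
      natural_isomorphism_dlun natural_isomorphism_drun natural_isomorphism_dasc
      triangle_Q pentagon_Q
    | simp add: Q_simps V_inf_simps(1) deco_Obj hid_Obj composable2_Obj composable3_Obj hcomp1_Obj
        globular_cell lun_iso run_iso asc_iso)+

lemma globularily_generated_Q: "globularily_generated (Q B)"
proof -
  have "cl x \<in> generated_squares (Q B)" if "x \<in> formal B" for x
    using that
  proof induction
    case (formal_empty \<alpha>)
    \<comment> \<open>\<open>generated_squares\<close> has no clause for identities; the identity at
      \<alpha> is generated as the class of an identity cell, which is globular.\<close>
    then have "cl (empty_path \<alpha>) = cl (cell B (Ide (cells B) \<alpha>))"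
      by (intro cl_eqI R_inf.ide_cell)
    then show ?case
      using formal_empty by (simp add: globular_cell K.Ide generated_squares.globular)
  next
    case (formal_cell \<phi>)
    then show ?case
      by (simp add: globular_cell generated_squares.globular)
  next
    case (formal_hsym f)
    then show ?case
      using generated_squares.horizontal_identity[of f "Q B"] by (simp add: Q_simps)
  next
    case (formal_vcomp x y)
    then have "vdefined B y x"
      by (simp add: vdefined_def E_inf_eq_formal)
    then show ?case
      using generated_squares.vertical[OF formal_vcomp(4,5)] formal_vcomp(1-3)
      by (simp add: Q_simps V_inf_simps(4,5) Cmp_V_inf E_inf_eq_formal)
  next
    case (formal_hconc x y)
    then have "hdefined B y x"
      by (simp add: hdefined_def E_inf_eq_formal)
    then show ?case
      using generated_squares.horizontal[OF formal_hconc(4,5)] formal_hconc(1-3)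
      by (simp add: Q_simps(11,12) hsq_Q E_inf_eq_formal)
  qed
  then show ?thesis
    by (auto simp: globularily_generated_def Q_simps(2) V_inf_simps(2) E_inf_eq_formal)
qed

end

theorem theorem2p16:
  fixes B :: "('a, 'h, 'c, 'f) dbicat"
  assumes "decorated_bicategory B"
  shows "double_category (Q B) \<and> globularily_generated (Q B)"
proof -
  interpret decorated_bicategory B by fact
  show ?thesis
    using double_category_Q globularily_generated_Q by simp
qed

end
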